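(* Let $\gamma$ be a translation-invariant (nonnull) specification, $\lambda\in\mathcal M^+_{1,\mathrm{inv}}$, and $\mu,\nu\in\mathcal G_{\mathrm{inv}}(\gamma)$. Assume Condition C1': $(\lambda\otimes\mu)\big(\{(\xi,\sigma):\sigma^\xi\in\Omega_\gamma\}\big)=1$, and Condition C2': $\lim_{n\to\infty}\frac1{|\Lambda_n|}\int_\Omega\log\frac{d\mu_{\Lambda_n}}{d\nu_{\Lambda_n}}(\xi_{\Lambda_n})\,\lambda(d\xi)=0$. Then: (1) $h(\mu|\nu)$ exists and equals $0$; (2) $e^\lambda_\nu$ exists and $e^\lambda_\nu=e^\lambda_\mu$; (3) $h(\alpha|\nu)$ exists for every $\alpha\in\mathcal M^+_{1,\mathrm{inv}}$ satisfying $(\lambda\otimes\alpha)\big(\{(\xi,\sigma):\sigma^\xi\in\Omega_\gamma\}\big)=1$.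
   Context: Let $E$ be a finite set, $\Omega=E^{\mathbb Z^d}$ with product topology and Borel $\sigma$-field $\mathcal F$; $\mathcal F_\Lambda$ is generated by the coordinates in $\Lambda$; $\mathcal S$ = finite subsets of $\mathbb Z^d$; $\mu(\sigma_\Lambda)=\mu(\{\omega:\omega_\Lambda=\sigma_\Lambda\})$ and $\mu_\Lambda$ is the law of $\omega_\Lambda$ under $\mu$; local functions are $\mathcal F_\Delta$-measurable for some finite $\Delta$. Translations $(\tau_x\omega)(y)=\omega(x+y)$; $\mathcal M^+_{1,\mathrm{inv}}$ = translation-invariant probability measures. A specification $\gamma=(\gamma_\Lambda)_{\Lambda\in\mathcal S}$ is a family of probability kernels, $\mathcal F_{\Lambda^c}$-measurable in the boundary condition, proper, consistent ($\int\gamma_\Lambda(A|\omega')\gamma_{\Lambda'}(d\omega'|\omega)=\gamma_{\Lambda'}(A|\omega)$ for $\Lambda\subset\Lambda'$ and all $\omega$) and nonnull ($0<a_\Lambda<\inf_{\sigma,\eta}\gamma_\Lambda(\sigma_\Lambda|\eta)\le\sup_{\sigma,\eta}\gamma_\Lambda(\sigma_\Lambda|\eta)<b_\Lambda<1$); translation-invariant means $\gamma_{\Lambda+x}(A|\omega)=\gamma_\Lambda(\tau_xA|\tau_x\omega)$. $\mathcal G(\gamma)$: probability measures $\mu$ with $\mu(A|\mathcal F_{\Lambda^c})=\gamma_\Lambda(A|\cdot)$ $\mu$-a.s. for all $\Lambda,A$; $\mathcal G_{\mathrm{inv}}(\gamma)=\mathcal G(\gamma)\cap\mathcal M^+_{1,\mathrm{inv}}$.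 $\Omega_\gamma$ is the set of $\omega$ at which $\omega'\mapsto\int f\,d\gamma_\Lambda(\cdot|\omega')$ is continuous for all $\Lambda\in\mathcal S$ and local $f$. For the lexicographic order $\le$ on $\mathbb Z^d$, $\sigma^\xi(x)=\sigma(x)$ if $x\le0$ and $\xi(x)$ if $x>0$. $\Lambda_n=[-n,n]^d\cap\mathbb Z^d$. For a probability measure $\rho$, $e^\lambda_\rho=-\lim_{n\to\infty}|\Lambda_n|^{-1}\int_\Omega\log\rho(\xi_{\Lambda_n})\,\lambda(d\xi)$ whenever the limit exists. $h_\Lambda(\mu|\nu)=\sum_{\sigma_\Lambda}\mu(\sigma_\Lambda)\log\frac{\mu(\sigma_\Lambda)}{\nu(\sigma_\Lambda)}$, and $h(\mu|\nu)=\lim_n|\Lambda_n|^{-1}h_{\Lambda_n}(\mu|\nu)$ when it exists. *)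

theory Defs
  imports "HOL-Probability.Probability"
begin

text \<open>Sites: the lattice Z^d is rendered as (int, 'd) vec with a finite, linearly ordered
index type 'd (so d = CARD('d)); the spin space E is a finite type 'e carrying the
discrete topology. Configurations are functions ((int, 'd) vec) \<Rightarrow> 'e, with the product
topology (config_topology) and the product sigma-algebra.\<close>

type_synonym ('d, 'e) config = "((int, 'd) vec) \<Rightarrow> 'e"

definition Omega :: "('d::finite, 'e) config measure" where
  "Omega = PiM UNIV (\<lambda>_. count_space UNIV)"

definition F_alg :: "((int, 'd::finite) vec) set \<Rightarrow> ('d, 'e) config measure" where
  "F_alg L = vimage_algebra (space Omega) (\<lambda>\<omega>. restrict \<omega> L) (PiM L (\<lambda>_. count_space UNIV))"

definition prob_on_Omega :: "('d::finite, 'e) config measure \<Rightarrow> bool" where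
  "prob_on_Omega \<mu> \<longleftrightarrow> prob_space \<mu> \<and> sets \<mu> = sets Omega"

definition cyl :: "((int, 'd::finite) vec) set \<Rightarrow> ('d, 'e) config \<Rightarrow> ('d, 'e) config set" where
  "cyl L \<sigma> = {\<omega>. \<forall>x\<in>L. \<omega> x = \<sigma> x}"

definition shift :: "(int, 'd::finite) vec \<Rightarrow> ('d, 'e) config \<Rightarrow> ('d, 'e) config" where
  "shift x \<omega> = (\<lambda>y. \<omega> (x + y))"

definition translation_invariant :: "('d::finite, 'e) config measure \<Rightarrow> bool" where
  "translation_invariant \<mu> \<longleftrightarrow> (\<forall>x. \<forall>A\<in>sets Omega. measure \<mu> (shift x -` A) = measure \<mu> A)"

definition inv_prob :: "('d::finite, 'e) config measure \<Rightarrow> bool" where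
  "inv_prob \<mu> \<longleftrightarrow> prob_on_Omega \<mu> \<and> translation_invariant \<mu>"

definition is_spec ::
  "(((int, 'd::finite) vec) set \<Rightarrow> ('d, 'e) config \<Rightarrow> ('d, 'e) config measure) \<Rightarrow> bool" where
  "is_spec \<gamma> \<longleftrightarrow>
     (\<forall>L. finite L \<longrightarrow>
        (\<forall>\<omega>. prob_space (\<gamma> L \<omega>) \<and> sets (\<gamma> L \<omega>) = sets Omega) \<and>
        (\<forall>A\<in>sets Omega. (\<lambda>\<omega>. measure (\<gamma> L \<omega>) A) \<in> borel_measurable (F_alg (- L))) \<and>
        (\<forall>A\<in>sets Omega. \<forall>B\<in>sets (F_alg (- L)). \<forall>\<omega>.
            measure (\<gamma> L \<omega>) (A \<inter> B) = indicator B \<omega> * measure (\<gamma> L \<omega>) A)) \<and>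
     (\<forall>L L'. finite L' \<and> L \<subseteq> L' \<longrightarrow>
        (\<forall>A\<in>sets Omega. \<forall>\<omega>.
            (\<integral>\<omega>'. measure (\<gamma> L \<omega>') A \<partial>(\<gamma> L' \<omega>)) = measure (\<gamma> L' \<omega>) A))"

definition nonnull ::
  "(((int, 'd::finite) vec) set \<Rightarrow> ('d, 'e) config \<Rightarrow> ('d, 'e) config measure) \<Rightarrow> bool" where
  "nonnull \<gamma> \<longleftrightarrow> (\<forall>L. finite L \<and> L \<noteq> {} \<longrightarrow>
     (\<exists>a b. 0 < a \<and> b < 1 \<and>
        (\<forall>\<sigma> \<eta>. a \<le> measure (\<gamma> L \<eta>) (cyl L \<sigma>) \<and> measure (\<gamma> L \<eta>) (cyl L \<sigma>) \<le> b)))"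

definition spec_translation_invariant ::
  "(((int, 'd::finite) vec) set \<Rightarrow> ('d, 'e) config \<Rightarrow> ('d, 'e) config measure) \<Rightarrow> bool" where
  "spec_translation_invariant \<gamma> \<longleftrightarrow> (\<forall>L x. finite L \<longrightarrow> (\<forall>A\<in>sets Omega. \<forall>\<omega>.
     measure (\<gamma> ((\<lambda>y. y + x) ` L) \<omega>) A = measure (\<gamma> L (shift x \<omega>)) (shift x ` A)))"

text \<open>Gibbs measures: mu(A | F_{Lambda^c}) = gamma_Lambda(A | .) mu-a.s., written out via the
defining property of conditional probability (gamma_Lambda(A|.) is F_{Lambda^c}-measurable).\<close>
definition Gibbs ::
  "(((int, 'd::finite) vec) set \<Rightarrow> ('d, 'e) config \<Rightarrow> ('d, 'e) config measure) \<Rightarrow> ('d, 'e) config measure \<Rightarrow> bool" where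
  "Gibbs \<gamma> \<mu> \<longleftrightarrow> prob_on_Omega \<mu> \<and>
     (\<forall>L. finite L \<longrightarrow> (\<forall>A\<in>sets Omega. \<forall>B\<in>sets (F_alg (- L)).
        measure \<mu> (A \<inter> B) = (\<integral>\<omega>. indicator B \<omega> * measure (\<gamma> L \<omega>) A \<partial>\<mu>)))"

definition Gibbs_inv where
  "Gibbs_inv \<gamma> \<mu> \<longleftrightarrow> Gibbs \<gamma> \<mu> \<and> translation_invariant \<mu>"

definition local_fun :: "(('d::finite, 'e) config \<Rightarrow> real) \<Rightarrow> bool" where
  "local_fun f \<longleftrightarrow> (\<exists>D. finite D \<and> f \<in> borel_measurable (F_alg D))"

definition config_topology :: "('d::finite, 'e) config topology" where
  "config_topology = product_topology (\<lambda>_. discrete_topology UNIV) UNIV"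

definition Omega_gamma ::
  "(((int, 'd::finite) vec) set \<Rightarrow> ('d, 'e) config \<Rightarrow> ('d, 'e) config measure) \<Rightarrow> ('d, 'e) config set" where
  "Omega_gamma \<gamma> = {\<omega>. \<forall>L f. finite L \<and> local_fun f \<longrightarrow>
      limitin euclideanreal (\<lambda>\<omega>'. \<integral>\<eta>. f \<eta> \<partial>(\<gamma> L \<omega>'))
        (\<integral>\<eta>. f \<eta> \<partial>(\<gamma> L \<omega>)) (atin config_topology \<omega>)}"

definition lex_less :: "((int, 'd::{finite,linorder}) vec) \<Rightarrow> (int, 'd) vec \<Rightarrow> bool" where
  "lex_less x y \<longleftrightarrow> (\<exists>i. x $ i < y $ i \<and> (\<forall>j<i. x $ j = y $ j))"

definition glue :: "('d::{finite,linorder}, 'e) config \<Rightarrow> ('d, 'e) config \<Rightarrow> ('d, 'e) config" where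
  "glue \<sigma> \<xi> = (\<lambda>x. if x = 0 \<or> lex_less x 0 then \<sigma> x else \<xi> x)"

definition cube :: "nat \<Rightarrow> ((int, 'd::finite) vec) set" where
  "cube n = {x. \<forall>i. - int n \<le> x $ i \<and> x $ i \<le> int n}"

definition ent_seq :: "('d::finite, 'e) config measure \<Rightarrow> ('d, 'e) config measure \<Rightarrow> nat \<Rightarrow> real" where
  "ent_seq lam \<rho> n = - (1 / real (card (cube n :: ((int, 'd) vec) set))) *
      (\<integral>\<xi>. ln (measure \<rho> (cyl (cube n) \<xi>)) \<partial>lam)"

definition h_local :: "((int, 'd::finite) vec) set \<Rightarrow> ('d, 'e::finite) config measure \<Rightarrow> ('d, 'e) config measure \<Rightarrow> real" where
  "h_local L \<mu> \<nu> = (\<Sum>\<sigma>\<in>PiE L (\<lambda>_. UNIV).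
      measure \<mu> (cyl L \<sigma>) * ln (measure \<mu> (cyl L \<sigma>) / measure \<nu> (cyl L \<sigma>)))"

definition rel_ent_seq :: "('d::finite, 'e::finite) config measure \<Rightarrow> ('d, 'e) config measure \<Rightarrow> nat \<Rightarrow> real" where
  "rel_ent_seq \<mu> \<nu> n = h_local (cube n) \<mu> \<nu> / real (card (cube n :: ((int, 'd) vec) set))"

text \<open>the C2' quantity: |Lambda_n|^{-1} int log (d mu_{Lambda_n}/d nu_{Lambda_n})(xi_{Lambda_n}) lambda(d xi);
the density of the finite marginals is the ratio of cylinder probabilities.\<close>
definition C2_seq :: "('d::finite, 'e) config measure \<Rightarrow> ('d, 'e) config measure \<Rightarrow> ('d, 'e) config measure \<Rightarrow> nat \<Rightarrow> real" where
  "C2_seq lam \<mu> \<nu> n = (1 / real (card (cube n :: ((int, 'd) vec) set))) *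
      (\<integral>\<xi>. ln (measure \<mu> (cyl (cube n) \<xi>) / measure \<nu> (cyl (cube n) \<xi>)) \<partial>lam)"

end

theory Submission
  imports Defs
begin

text \<open>
  Changing \<open>\<xi>\<close> into \<open>\<sigma>\<close> on a cube one site at a time, in lexicographic order, writes
  \<open>ln (\<nu>(\<sigma>) / \<nu>(\<xi>))\<close> as a sum of single-site log ratios. Each of them is an average of
  \<open>\<gamma>\<close> at the origin over boundary conditions that agree with the shift of \<open>\<sigma>\<close> glued to \<open>\<xi>\<close>
  on a large box, so by C1' and dominated convergence the cross entropies per site satisfy
  \<open>e\<^sup>\<lambda>(\<nu>) - e\<^sup>\<alpha>(\<nu>) \<rightarrow> c\<close> with \<open>c\<close> depending on \<open>\<gamma>, \<lambda>, \<alpha>\<close> but not on the Gibbs measure \<open>\<nu>\<close>.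
  The entropy density of an invariant measure exists: the same telescoping writes it as an average
  of conditional entropies, which decrease in the box. Together with C2' these limits
  give all three claims.
\<close>

subsection \<open>Finite-range functions of a configuration\<close>

text \<open>The obstacle is that \<open>\<gamma>\<close> is continuous only on
  \<open>Omega_gamma\<close>, which C1' reaches only through glued configurations. The lexicographic
  order is made for this: just before the step at a site x, the sites before x carry \<sigma> and
  those after it carry \<xi>, so the surroundings seen from x are those of a glued pair, and
  invariance of \<lambda> and \<alpha> gives that pair the same law at every x. Convergence of a
  step is then only almost sure; nonnullness supplies the bound that allows integration, and sites
  near the boundary of the cube are a vanishing fraction. With \<alpha> = \<mu>, the same c serves
  for both Gibbs measures \<mu> and \<nu>, and subtracting cancels it: the relative entropy per
  site, e^\<mu>(\<nu>) - e^\<mu>(\<mu>), differs by o(1) from e^\<lambda>(\<nu>) -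
  e^\<lambda>(\<mu>), which is the C2' quantity. This already is claim (1). The entropy density
  enters only afterwards, to turn differences into limits: e^\<mu>(\<mu>) fixes the limit of
  e^\<lambda>(\<mu>), C2' carries it to e^\<lambda>(\<nu>), and from there one reaches
  e^\<alpha>(\<nu>) for claim (3).\<close>

definition depends_on :: "'a set \<Rightarrow> (('a \<Rightarrow> 'e) \<Rightarrow> 'c) \<Rightarrow> bool" where
  "depends_on L f \<longleftrightarrow> (\<forall>\<sigma> \<tau>. (\<forall>x\<in>L. \<sigma> x = \<tau> x) \<longrightarrow> f \<sigma> = f \<tau>)"

lemma space_Omega [simp]: "space Omega = UNIV"
  by (simp add: Omega_def space_PiM)

lemma cyl_empty [simp]: "cyl {} \<omega> = UNIV"
  by (simp add: cyl_def)

lemma cyl_cong: "(\<And>x. x \<in> L \<Longrightarrow> \<sigma> x = \<tau> x) \<Longrightarrow> cyl L \<sigma> = cyl L \<tau>"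
  by (auto simp: cyl_def)

lemma cyl_mono: "L \<subseteq> L' \<Longrightarrow> cyl L' \<omega> \<subseteq> cyl L \<omega>"
  by (auto simp: cyl_def)

lemma depends_on_cyl: "L \<subseteq> L' \<Longrightarrow> depends_on L' (\<lambda>\<omega>. g (cyl L \<omega>))"
  unfolding depends_on_def by (metis cyl_cong subsetD)

lemma measurable_coordinate: "(\<lambda>\<omega>. \<omega> x) \<in> measurable Omega (count_space UNIV)"
  unfolding Omega_def by (rule measurable_component_singleton) simp

lemma measurable_into_Omega:
  assumes "\<And>x. (\<lambda>w. g w x) \<in> measurable M (count_space UNIV)"
  shows "g \<in> measurable M Omega"
  unfolding Omega_def by (rule measurable_PiM_single') (use assms in auto)

lemma cyl_sets [simp]:
  assumes "finite L"
  shows "cyl L \<sigma> \<in> sets Omega"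
proof -
  have "{\<omega> \<in> space Omega. \<forall>x\<in>L. \<omega> x = \<sigma> x} \<in> sets Omega"
  proof (rule sets.sets_Collect_finite_All[OF _ assms])
    fix x
    have "(\<lambda>\<omega>. \<omega> x) -` {\<sigma> x} \<inter> space Omega \<in> sets Omega"
      by (rule measurable_sets[OF measurable_coordinate]) simp
    then show "{\<omega> \<in> space Omega. \<omega> x = \<sigma> x} \<in> sets Omega"
      by (simp add: vimage_def)
  qed
  then show ?thesis by (simp add: cyl_def)
qed

text \<open>The spin space is finite, so such a function is simple; measurability, integrability and
  explicit integrals all come from this expansion. The representatives in \<open>PiE\<close> are
  undefined off \<open>L\<close>, which is harmless because \<open>f\<close> looks at
  \<open>L\<close> only.\<close>

lemma depends_on_eq_sum:
  fixes f :: "('d::finite, 'e::finite) config \<Rightarrow> real"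
  assumes "finite L" "depends_on L f"
  shows "f \<omega> = (\<Sum>\<sigma>\<in>PiE L (\<lambda>_. UNIV). f \<sigma> * indicator (cyl L \<sigma>) \<omega>)"
proof -
  let ?r = "restrict \<omega> L"
  have r: "?r \<in> PiE L (\<lambda>_. UNIV)" by auto
  have "(\<Sum>\<sigma>\<in>PiE L (\<lambda>_. UNIV). f \<sigma> * indicator (cyl L \<sigma>) \<omega>)
      = (\<Sum>\<sigma>\<in>PiE L (\<lambda>_. UNIV). if \<sigma> = ?r then f \<sigma> else 0)"
  proof (rule sum.cong[OF refl])
    fix \<sigma> :: "('d, 'e) config" assume s: "\<sigma> \<in> PiE L (\<lambda>_. UNIV)"
    have "\<omega> \<in> cyl L \<sigma> \<longleftrightarrow> \<sigma> = ?r"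
    proof
      assume "\<omega> \<in> cyl L \<sigma>"
      then show "\<sigma> = ?r"
        by (intro PiE_ext[OF s r]) (auto simp: cyl_def)
    qed (auto simp: cyl_def)
    then show "f \<sigma> * indicator (cyl L \<sigma>) \<omega> = (if \<sigma> = ?r then f \<sigma> else 0)"
      by (auto simp: indicator_def)
  qed
  also have "\<dots> = f ?r"
    using r assms(1) by (simp add: finite_PiE)
  also have "\<dots> = f \<omega>"
    using assms(2) unfolding depends_on_def by (metis restrict_apply')
  finally show ?thesis ..
qed

lemma measurable_depends_on:
  fixes f :: "('d::finite, 'e::finite) config \<Rightarrow> real"
  assumes "finite L" "depends_on L f"
  shows "f \<in> borel_measurable Omega"
proof -
  have "(\<lambda>\<omega>. \<Sum>\<sigma>\<in>PiE L (\<lambda>_. UNIV). f \<sigma> * indicator (cyl L \<sigma>) \<omega>) \<in> borel_measurable Omega"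
    using assms(1) by (intro borel_measurable_sum borel_measurable_times borel_measurable_indicator) auto
  then show ?thesis
    by (subst depends_on_eq_sum[OF assms, abs_def])
qed

lemma prob_on_Omega_D:
  assumes "prob_on_Omega \<mu>"
  shows "prob_space \<mu>" "sets \<mu> = sets Omega" "space \<mu> = UNIV"
  using assms sets_eq_imp_space_eq[of \<mu> Omega] by (auto simp: prob_on_Omega_def)

lemma integral_depends_on:
  fixes f :: "('d::finite, 'e::finite) config \<Rightarrow> real"
  assumes "prob_on_Omega \<mu>" "finite L" "depends_on L f"
  shows "integrable \<mu> f"
    and "(\<integral>\<omega>. f \<omega> \<partial>\<mu>) = (\<Sum>\<sigma>\<in>PiE L (\<lambda>_. UNIV). measure \<mu> (cyl L \<sigma>) * f \<sigma>)"
proof -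
  interpret prob_space \<mu> by (rule prob_on_Omega_D(1)[OF assms(1)])
  have cyl: "cyl L \<sigma> \<in> sets \<mu>" for \<sigma>
    using prob_on_Omega_D(2)[OF assms(1)] assms(2) by simp
  have I: "integrable \<mu> (\<lambda>\<omega>. f \<sigma> * indicator (cyl L \<sigma>) \<omega>)" for \<sigma>
    using cyl by (intro integrable_mult_right integrable_real_indicator) (auto simp: emeasure_eq_measure)
  have eq: "f = (\<lambda>\<omega>. \<Sum>\<sigma>\<in>PiE L (\<lambda>_. UNIV). f \<sigma> * indicator (cyl L \<sigma>) \<omega>)"
    by (rule ext) (rule depends_on_eq_sum[OF assms(2,3)])
  have "integrable \<mu> (\<lambda>\<omega>. \<Sum>\<sigma>\<in>PiE L (\<lambda>_. UNIV). f \<sigma> * indicator (cyl L \<sigma>) \<omega>)"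
    using I by (rule Bochner_Integration.integrable_sum)
  then show "integrable \<mu> f" by (subst eq)
  have "(\<integral>\<omega>. f \<omega> \<partial>\<mu>) = (\<integral>\<omega>. (\<Sum>\<sigma>\<in>PiE L (\<lambda>_. UNIV). f \<sigma> * indicator (cyl L \<sigma>) \<omega>) \<partial>\<mu>)"
    by (subst eq) simp
  also have "\<dots> = (\<Sum>\<sigma>\<in>PiE L (\<lambda>_. UNIV). (\<integral>\<omega>. f \<sigma> * indicator (cyl L \<sigma>) \<omega> \<partial>\<mu>))"
    using I by (rule Bochner_Integration.integral_sum)
  also have "\<dots> = (\<Sum>\<sigma>\<in>PiE L (\<lambda>_. UNIV). measure \<mu> (cyl L \<sigma>) * f \<sigma>)"
    by (intro sum.cong) (use cyl prob_on_Omega_D(3)[OF assms(1)] in \<open>simp_all add: mult.commute\<close>)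
  finally show "(\<integral>\<omega>. f \<omega> \<partial>\<mu>) = (\<Sum>\<sigma>\<in>PiE L (\<lambda>_. UNIV). measure \<mu> (cyl L \<sigma>) * f \<sigma>)" .
qed

lemma sum_measure_cyl:
  fixes \<mu> :: "('d::finite, 'e::finite) config measure"
  assumes "prob_on_Omega \<mu>" "finite L"
  shows "(\<Sum>\<sigma>\<in>PiE L (\<lambda>_. UNIV). measure \<mu> (cyl L \<sigma>)) = 1"
  using integral_depends_on(2)[OF assms, of "\<lambda>_. 1"]
    prob_space.prob_space[OF prob_on_Omega_D(1)[OF assms(1)]]
  by (simp add: depends_on_def)

lemma sum_measure_cyl_insert:
  fixes \<mu> :: "('d::finite, 'e::finite) config measure"
  assumes "prob_on_Omega \<mu>" "finite L" "x \<notin> L"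
  shows "(\<Sum>s\<in>UNIV. measure \<mu> (cyl (insert x L) (\<sigma>(x := s)))) = measure \<mu> (cyl L \<sigma>)"
proof -
  interpret prob_space \<mu> by (rule prob_on_Omega_D(1)[OF assms(1)])
  have "measure \<mu> (\<Union>s\<in>UNIV. cyl (insert x L) (\<sigma>(x := s)))
      = (\<Sum>s\<in>UNIV. measure \<mu> (cyl (insert x L) (\<sigma>(x := s))))"
  proof (rule finite_measure_finite_Union)
    show "disjoint_family_on (\<lambda>s. cyl (insert x L) (\<sigma>(x := s))) UNIV"
      unfolding disjoint_family_on_def cyl_def by auto
    show "(\<lambda>s. cyl (insert x L) (\<sigma>(x := s))) ` UNIV \<subseteq> sets \<mu>"
      using assms(2) prob_on_Omega_D(2)[OF assms(1)] by (simp add: image_subset_iff)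
  qed simp
  moreover have "(\<Union>s\<in>UNIV. cyl (insert x L) (\<sigma>(x := s))) = cyl L \<sigma>"
  proof (rule set_eqI)
    fix \<omega>
    have "\<omega> \<in> cyl (insert x L) (\<sigma>(x := s)) \<longleftrightarrow> \<omega> \<in> cyl L \<sigma> \<and> \<omega> x = s" for s
      using assms(3) by (auto simp: cyl_def)
    then show "\<omega> \<in> (\<Union>s\<in>UNIV. cyl (insert x L) (\<sigma>(x := s))) \<longleftrightarrow> \<omega> \<in> cyl L \<sigma>" by simp
  qed
  ultimately show ?thesis by simp
qed

subsection \<open>Translations\<close>

lemma measurable_shift: "shift x \<in> measurable Omega Omega"
proof (rule measurable_into_Omega)
  fix y show "(\<lambda>w. shift x w y) \<in> measurable Omega (count_space UNIV)"
    unfolding shift_def by (rule measurable_coordinate)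
qed

lemma distr_shift:
  assumes "inv_prob \<mu>"
  shows "distr \<mu> \<mu> (shift x) = \<mu>"
proof -
  have p: "prob_on_Omega \<mu>" and t: "translation_invariant \<mu>"
    using assms by (auto simp: inv_prob_def)
  interpret prob_space \<mu> by (rule prob_on_Omega_D(1)[OF p])
  have m: "shift x \<in> measurable \<mu> \<mu>"
    using measurable_shift measurable_cong_sets[OF prob_on_Omega_D(2)[OF p] prob_on_Omega_D(2)[OF p]] by blast
  show ?thesis
  proof (rule measure_eqI)
    fix A assume "A \<in> sets (distr \<mu> \<mu> (shift x))"
    then have A: "A \<in> sets \<mu>" by simp
    then have "measure \<mu> (shift x -` A) = measure \<mu> A"
      using t prob_on_Omega_D(2)[OF p] by (auto simp: translation_invariant_def)
    then show "emeasure (distr \<mu> \<mu> (shift x)) A = emeasure \<mu> A"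
      using emeasure_distr[OF m A] prob_on_Omega_D(3)[OF p] by (simp add: emeasure_eq_measure)
  qed simp
qed

lemma cyl_shift: "shift x -` cyl ((\<lambda>y. y - x) ` L) (shift x \<sigma>) = cyl L \<sigma>"
  by (simp add: cyl_def shift_def vimage_def)

lemma measure_cyl_shift:
  assumes "inv_prob \<mu>" "finite L"
  shows "measure \<mu> (cyl ((\<lambda>y. y - x) ` L) (shift x \<sigma>)) = measure \<mu> (cyl L \<sigma>)"
  using assms cyl_shift[of x L \<sigma>] cyl_sets[of "(\<lambda>y. y - x) ` L" "shift x \<sigma>"]
  unfolding inv_prob_def translation_invariant_def by (metis finite_imageI)

subsection \<open>The lexicographic order\<close>

lemma lex_less_irrefl: "\<not> lex_less x x"
  by (simp add: lex_less_def)

lemma lex_less_trans: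
  assumes "lex_less x y" "lex_less y z"
  shows "lex_less x z"
proof -
  obtain i j where i: "x $ i < y $ i" "\<forall>k<i. x $ k = y $ k"
    and j: "y $ j < z $ j" "\<forall>k<j. y $ k = z $ k"
    using assms by (auto simp: lex_less_def)
  have "x $ min i j < z $ min i j"
    using i j by (cases i j rule: linorder_cases) (auto simp: min_def)
  moreover have "\<forall>k<min i j. x $ k = z $ k" using i j by auto
  ultimately show ?thesis by (auto simp: lex_less_def)
qed

text \<open>The first coordinate of disagreement decides; it exists because the index type is finite
  and linearly ordered.\<close>

lemma lex_less_total:
  assumes "x \<noteq> y"
  shows "lex_less x y \<or> lex_less y x"
proof -
  let ?D = "{i. x $ i \<noteq> y $ i}"
  have ne: "?D \<noteq> {}" using assms by (auto simp: vec_eq_iff)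
  then have "Min ?D \<in> ?D" by (intro Min_in) auto
  moreover have "x $ j = y $ j" if "j < Min ?D" for j
  proof (rule ccontr)
    assume "x $ j \<noteq> y $ j"
    then have "Min ?D \<le> j" by (intro Min_le) auto
    then show False using that by simp
  qed
  ultimately show ?thesis
    unfolding lex_less_def by (metis (mono_tags, lifting) linorder_neqE mem_Collect_eq)
qed

lemma lex_less_diff: "lex_less (y - x) 0 \<longleftrightarrow> lex_less y x"
  by (simp add: lex_less_def)

text \<open>Induction removes the greatest site \<open>m\<close>: it lies in no initial segment of
  another site, and its own step is the last one, from \<open>L - {m}\<close> to
  \<open>L\<close>.\<close>

lemma sum_telescope_lex:
  fixes F :: "(int, 'd::{finite,linorder}) vec set \<Rightarrow> real"
  assumes "finite L"
  shows "(\<Sum>x\<in>L. F {y \<in> L. y = x \<or> lex_less y x} - F {y \<in> L. lex_less y x}) = F L - F {}"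
  using assms
proof (induction "card L" arbitrary: L)
  case 0
  then show ?case by simp
next
  case (Suc n)
  have "asymp_on L lex_less" "transp_on L lex_less"
    using lex_less_irrefl lex_less_trans by (auto simp: asymp_on_def transp_on_def)
  moreover have "L \<noteq> {}" using Suc.hyps(2) by auto
  ultimately obtain m where m: "m \<in> L" "\<forall>x\<in>L. \<not> lex_less m x"
    using Finite_Set.bex_max_element[OF Suc.prems] by (metis lex_less_irrefl)
  define K where "K = L - {m}"
  have K: "finite K" "n = card K" "L = insert m K" "m \<notin> K"
    using Suc.prems Suc.hyps(2) m(1) by (auto simp: K_def)
  have below: "lex_less x m" if "x \<in> K" for x
    using that m K lex_less_total by (metis insertCI)
  have "{y \<in> L. y = x \<or> lex_less y x} = {y \<in> K. y = x \<or> lex_less y x}"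
       "{y \<in> L. lex_less y x} = {y \<in> K. lex_less y x}" if "x \<in> K" for x
    using that below[OF that] K m by auto
  then have "(\<Sum>x\<in>K. F {y \<in> L. y = x \<or> lex_less y x} - F {y \<in> L. lex_less y x})
      = (\<Sum>x\<in>K. F {y \<in> K. y = x \<or> lex_less y x} - F {y \<in> K. lex_less y x})"
    by (intro sum.cong) auto
  also have "\<dots> = F K - F {}" using Suc.hyps(1)[OF K(2,1)] .
  moreover have "{y \<in> L. y = m \<or> lex_less y m} = L" "{y \<in> L. lex_less y m} = K"
    using below K lex_less_irrefl by auto
  ultimately show ?case using K by simp
qed

subsection \<open>Averages over cubes\<close>

lemma cube_eq: "(cube n :: (int, 'd::finite) vec set) = vec_lambda ` PiE UNIV (\<lambda>_. {- int n..int n})"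
proof (rule set_eqI)
  fix x :: "(int, 'd::finite) vec"
  show "x \<in> cube n \<longleftrightarrow> x \<in> vec_lambda ` PiE UNIV (\<lambda>_. {- int n..int n})"
    by (auto simp: cube_def image_iff intro!: bexI[of _ "vec_nth x"])
qed

lemma finite_cube [simp]: "finite (cube n)"
  unfolding cube_eq by (intro finite_imageI finite_PiE) auto

lemma card_cube: "card (cube n :: (int, 'd::finite) vec set) = (2 * n + 1) ^ CARD('d)"
proof -
  have "inj_on vec_lambda (PiE (UNIV :: 'd set) (\<lambda>_. {- int n..int n}))"
    by (auto simp: inj_on_def vec_lambda_inject)
  then show ?thesis
    unfolding cube_eq by (simp add: card_image card_PiE nat_add_distrib nat_mult_distrib)
qed

lemma cube_mono: "m \<le> n \<Longrightarrow> cube m \<subseteq> cube n"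
  unfolding cube_def by (auto intro: order_trans[rotated] order_trans)

lemma zero_in_cube [simp]: "0 \<in> cube n"
  by (simp add: cube_def)

lemma finite_subset_cube:
  assumes "finite (L :: (int, 'd::finite) vec set)"
  shows "\<exists>m. L \<subseteq> cube m"
proof
  let ?m = "\<Sum>x\<in>L. \<Sum>i\<in>UNIV. nat \<bar>x $ i\<bar>"
  show "L \<subseteq> cube ?m"
  proof
    fix x assume x: "x \<in> L"
    have "nat \<bar>x $ i\<bar> \<le> ?m" for i
    proof -
      have "nat \<bar>x $ i\<bar> \<le> (\<Sum>i\<in>UNIV. nat \<bar>x $ i\<bar>)"
        by (rule member_le_sum) auto
      also have "\<dots> \<le> ?m"
        by (rule member_le_sum[OF x, of "\<lambda>x. \<Sum>i\<in>UNIV. nat \<bar>x $ i\<bar>"]) (use assms in auto)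
      finally show ?thesis .
    qed
    then have "\<bar>x $ i\<bar> \<le> int ?m" for i
      using nat_le_iff by blast
    then have "- int ?m \<le> x $ i \<and> x $ i \<le> int ?m" for i
      by (metis abs_le_D1 abs_le_D2 minus_le_iff)
    then show "x \<in> cube ?m" unfolding cube_def by blast
  qed
qed

lemma cube_shift_subset:
  fixes x :: "(int, 'd::finite) vec"
  assumes "x \<in> cube (n - m)" "m \<le> n"
  shows "cube m \<subseteq> (\<lambda>y. y - x) ` cube n"
proof
  fix z :: "(int, 'd) vec" assume z: "z \<in> cube m"
  have "z + x \<in> cube n"
    unfolding cube_def
  proof (intro CollectI allI)
    fix i
    have "- int m \<le> z $ i" "z $ i \<le> int m" "- int (n - m) \<le> x $ i" "x $ i \<le> int (n - m)"
      using z assms(1) by (auto simp: cube_def)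
    then show "- int n \<le> (z + x) $ i \<and> (z + x) $ i \<le> int n"
      using assms(2) by (simp add: of_nat_diff)
  qed
  then show "z \<in> (\<lambda>y. y - x) ` cube n" by (auto intro!: image_eqI[of _ _ "z + x"])
qed

lemma card_cube_ratio:
  "(\<lambda>n. real (card (cube (n - m) :: (int, 'd::finite) vec set)) / real (card (cube n :: (int, 'd) vec set)))
    \<longlonglongrightarrow> 1"
proof -
  have "(\<lambda>n. real (2 * (n - m) + 1) / real (2 * n + 1)) \<longlonglongrightarrow> 1"
  \<comment> \<open>Shifting the index by \<open>m\<close> makes the truncated subtraction
    harmless.\<close>
  proof (rule LIMSEQ_offset[of _ m])
    have "(\<lambda>n. 1 - real (2 * m) * (1 / real (2 * (n + m) + 1))) \<longlonglongrightarrow> 1 - real (2 * m) * 0"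
      by (intro tendsto_intros real_tendsto_divide_at_top[OF tendsto_const]
          filterlim_compose[OF filterlim_real_sequentially] filterlim_subseq)
         (auto simp: strict_mono_def)
    moreover have "real (2 * (n + m - m) + 1) / real (2 * (n + m) + 1)
        = 1 - real (2 * m) * (1 / real (2 * (n + m) + 1))" for n
      by (simp add: field_simps)
    ultimately show "(\<lambda>n. real (2 * (n + m - m) + 1) / real (2 * (n + m) + 1)) \<longlonglongrightarrow> 1"
      by simp
  qed
  then have "(\<lambda>n. (real (2 * (n - m) + 1) / real (2 * n + 1)) ^ CARD('d)) \<longlonglongrightarrow> 1 ^ CARD('d)"
    by (rule tendsto_power)
  then show ?thesis by (simp only: card_cube of_nat_power power_divide power_one)
qed

text \<open>All but a vanishing fraction of the sites of a large cube see a large cube around them.\<close>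

lemma cube_average_tendsto:
  fixes G :: "(int, 'd::finite) vec set \<Rightarrow> real"
  assumes bounded: "\<And>L. finite L \<Longrightarrow> 0 \<in> L \<Longrightarrow> \<bar>G L\<bar> \<le> K"
    and limit: "\<And>e. e > 0 \<Longrightarrow> \<exists>m. \<forall>L. finite L \<and> cube m \<subseteq> L \<longrightarrow> \<bar>G L - c\<bar> \<le> e"
  shows "(\<lambda>n. (\<Sum>x\<in>cube n. G ((\<lambda>y. y - x) ` cube n)) / real (card (cube n :: (int, 'd) vec set)))
    \<longlonglongrightarrow> c"
proof (rule LIMSEQ_I)
  fix r :: real assume r: "r > 0"
  let ?N = "\<lambda>n. real (card (cube n :: (int, 'd) vec set))"
  \<comment> \<open>\<open>?C\<close> bounds the error at the sites outside
    \<open>cube (n - m)\<close>, where only \<open>bounded\<close> is available; each remaining site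
    contributes at most \<open>r / 2\<close>.\<close>
  let ?C = "K + \<bar>c\<bar>"
  obtain m where m: "\<And>L. finite L \<Longrightarrow> cube m \<subseteq> L \<Longrightarrow> \<bar>G L - c\<bar> \<le> r / 2"
    using limit[of "r / 2"] r by auto
  have "(\<lambda>n. r / 2 + (1 - ?N (n - m) / ?N n) * ?C) \<longlonglongrightarrow> r / 2 + (1 - 1) * ?C"
    by (intro tendsto_intros card_cube_ratio)
  then have "\<forall>\<^sub>F n in sequentially. r / 2 + (1 - ?N (n - m) / ?N n) * ?C < r"
    by (rule order_tendstoD) (use r in simp)
  moreover have "\<forall>\<^sub>F n in sequentially. m \<le> n" by (rule eventually_ge_at_top)
  ultimately have "\<forall>\<^sub>F n in sequentially.
      norm ((\<Sum>x\<in>cube n. G ((\<lambda>y. y - x) ` cube n)) / ?N n - c) < r"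
  proof eventually_elim
    case (elim n)
    let ?g = "\<lambda>x. G ((\<lambda>y. y - x) ` cube n) - c"
    have sub: "cube (n - m) \<subseteq> (cube n :: (int, 'd) vec set)" by (rule cube_mono) simp
    have pos: "?N n > 0" by (simp add: card_cube)
    have "\<bar>\<Sum>x\<in>cube n. ?g x\<bar> \<le> (\<Sum>x\<in>cube n. \<bar>?g x\<bar>)" by (rule sum_abs)
    also have "\<dots> = (\<Sum>x\<in>cube n - cube (n - m). \<bar>?g x\<bar>) + (\<Sum>x\<in>cube (n - m). \<bar>?g x\<bar>)"
      by (rule sum.subset_diff[OF sub finite_cube])
    also have "\<dots> \<le> (\<Sum>x\<in>(cube n :: (int, 'd) vec set) - cube (n - m). ?C)
        + (\<Sum>x\<in>(cube (n - m) :: (int, 'd) vec set). r / 2)"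
    proof (intro add_mono sum_mono)
      fix x :: "(int, 'd) vec" assume x: "x \<in> cube n - cube (n - m)"
      then have "0 \<in> (\<lambda>y. y - x) ` cube n" by (auto intro!: image_eqI[of _ _ x])
      then have "\<bar>G ((\<lambda>y. y - x) ` cube n)\<bar> \<le> K" by (intro bounded) auto
      then show "\<bar>?g x\<bar> \<le> ?C" by linarith
    next
      fix x :: "(int, 'd) vec" assume "x \<in> cube (n - m)"
      then show "\<bar>?g x\<bar> \<le> r / 2"
        using cube_shift_subset[of x n m] elim(2) by (intro m) auto
    qed
    also have "\<dots> = (?N n - ?N (n - m)) * ?C + ?N (n - m) * (r / 2)"
      using card_mono[OF finite_cube sub] by (simp add: card_Diff_subset[OF finite_cube sub] of_nat_diff)
    also have "\<dots> \<le> (?N n - ?N (n - m)) * ?C + ?N n * (r / 2)"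
      using card_mono[OF finite_cube sub] r by (intro add_left_mono mult_right_mono) auto
    also have "\<dots> = ?N n * (r / 2 + (1 - ?N (n - m) / ?N n) * ?C)"
    proof -
      have "?N n * (?N (n - m) / ?N n) = ?N (n - m)" using pos by (metis less_irrefl nonzero_mult_div_cancel_left times_divide_eq_right)
      then show ?thesis by (simp only: distrib_left left_diff_distrib right_diff_distrib mult.assoc[symmetric])
    qed
    also have "\<dots> < ?N n * r" using elim(1) pos by (intro mult_strict_left_mono)
    finally have "\<bar>\<Sum>x\<in>cube n. ?g x\<bar> < ?N n * r" .
    moreover have "(\<Sum>x\<in>cube n. G ((\<lambda>y. y - x) ` cube n)) / ?N n - c = (\<Sum>x\<in>cube n. ?g x) / ?N n"
    proof -
      have "(\<Sum>x\<in>(cube n :: (int, 'd) vec set). c) / ?N n = c"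
        using pos by (metis less_irrefl nonzero_mult_div_cancel_left sum_constant)
      then show ?thesis by (simp only: sum_subtractf diff_divide_distrib)
    qed
    ultimately show ?case
      using pos by (simp only: real_norm_def abs_divide abs_of_pos pos_divide_less_eq mult.commute)
  qed
  then show "\<exists>no. \<forall>n\<ge>no. norm ((\<Sum>x\<in>cube n. G ((\<lambda>y. y - x) ` cube n)) / ?N n - c) < r"
    by (simp add: eventually_sequentially)
qed

subsection \<open>The entropy density of an invariant measure\<close>

definition block_entropy :: "('d::finite, 'e) config measure \<Rightarrow> (int, 'd) vec set \<Rightarrow> real" where
  "block_entropy \<mu> L = - (\<integral>\<omega>. ln (measure \<mu> (cyl L \<omega>)) \<partial>\<mu>)"

lemma integrable_ln_cyl:
  fixes \<mu> :: "('d::finite, 'e::finite) config measure"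
  assumes "prob_on_Omega \<mu>" "finite L"
  shows "integrable \<mu> (\<lambda>\<omega>. ln (measure \<nu> (cyl L \<omega>)))"
  using assms by (intro integral_depends_on(1)[where L = L]) (auto intro: depends_on_cyl)

lemma block_entropy_empty:
  assumes "prob_on_Omega \<mu>"
  shows "block_entropy \<mu> {} = 0"
  using prob_space.prob_space[OF prob_on_Omega_D(1)[OF assms]] prob_on_Omega_D(3)[OF assms]
  by (simp add: block_entropy_def)

lemma block_entropy_translate:
  fixes \<mu> :: "('d::finite, 'e::finite) config measure"
  assumes "inv_prob \<mu>" "finite L"
  shows "block_entropy \<mu> ((\<lambda>y. y - x) ` L) = block_entropy \<mu> L"
proof -
  let ?f = "\<lambda>\<omega>. ln (measure \<mu> (cyl ((\<lambda>y. y - x) ` L) \<omega>))"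
  have p: "prob_on_Omega \<mu>" using assms(1) by (simp add: inv_prob_def)
  note s = prob_on_Omega_D(2)[OF p]
  have "(\<integral>\<omega>. ?f \<omega> \<partial>\<mu>) = (\<integral>\<omega>. ?f \<omega> \<partial>distr \<mu> \<mu> (shift x))"
    by (simp only: distr_shift[OF assms(1)])
  also have "\<dots> = (\<integral>\<omega>. ?f (shift x \<omega>) \<partial>\<mu>)"
  proof (rule integral_distr)
    show "shift x \<in> measurable \<mu> \<mu>"
      using measurable_shift measurable_cong_sets[OF s s] by blast
    show "?f \<in> borel_measurable \<mu>"
      using integrable_ln_cyl[OF p, of "(\<lambda>y. y - x) ` L" \<mu>] assms(2) by auto
  qed
  finally show ?thesis
    using assms by (simp add: block_entropy_def measure_cyl_shift)
qed

lemma sum_PiE_insert: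
  assumes "x \<notin> L"
  shows "(\<Sum>\<sigma>\<in>PiE (insert x L) (\<lambda>_. UNIV). f \<sigma>) = (\<Sum>\<sigma>\<in>PiE L (\<lambda>_. UNIV). \<Sum>s\<in>UNIV. f (\<sigma>(x := s)))"
proof -
  have "(\<Sum>\<sigma>\<in>PiE (insert x L) (\<lambda>_. UNIV). f \<sigma>)
      = (\<Sum>p\<in>UNIV \<times> PiE L (\<lambda>_. UNIV). f ((\<lambda>(y, g). g(x := y)) p))"
    unfolding PiE_insert_eq by (rule sum.reindex[OF inj_combinator[OF assms], unfolded comp_def])
  also have "\<dots> = (\<Sum>s\<in>UNIV. \<Sum>\<sigma>\<in>PiE L (\<lambda>_. UNIV). f (\<sigma>(x := s)))"
    by (simp add: sum.cartesian_product case_prod_unfold)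
  also have "\<dots> = (\<Sum>\<sigma>\<in>PiE L (\<lambda>_. UNIV). \<Sum>s\<in>UNIV. f (\<sigma>(x := s)))"
    by (rule sum.swap)
  finally show ?thesis .
qed

text \<open>Strong subadditivity, from \<open>ln r \<le> r - 1\<close> for the ratio \<open>r\<close> of the two conditional
  probabilities of the spin at \<open>x\<close>.\<close>

lemma block_entropy_increment_antimono:
  fixes \<mu> :: "('d::finite, 'e::finite) config measure"
  assumes p: "prob_on_Omega \<mu>" and fin: "finite D" and sub: "C \<subseteq> D" and x: "x \<notin> D"
  shows "block_entropy \<mu> (insert x D) - block_entropy \<mu> D
    \<le> block_entropy \<mu> (insert x C) - block_entropy \<mu> C"
proof -
  interpret prob_space \<mu> by (rule prob_on_Omega_D(1)[OF p])
  let ?m = "\<lambda>L \<sigma>. measure \<mu> (cyl L \<sigma>)"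
  let ?P = "PiE (insert x D) (\<lambda>_. UNIV) :: ('d, 'e) config set"
  let ?f = "\<lambda>\<sigma>. ln (?m (insert x C) \<sigma>) + ln (?m D \<sigma>) - ln (?m C \<sigma>) - ln (?m (insert x D) \<sigma>)"
  have finC: "finite C" and xC: "x \<notin> C" using fin sub x finite_subset by auto
  have sets: "cyl L \<sigma> \<in> sets \<mu>" if "finite L" for L \<sigma>
    using that prob_on_Omega_D(2)[OF p] by simp
  have mono: "?m L' \<sigma> \<le> ?m L \<sigma>" if "L \<subseteq> L'" "finite L'" for L L' \<sigma>
    using that by (intro finite_measure_mono cyl_mono sets) (auto intro: finite_subset)
  have dep: "depends_on (insert x D) ?f"
    unfolding depends_on_def
  proof (intro allI impI)
    fix \<sigma> \<tau> :: "('d, 'e) config"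
    assume "\<forall>y\<in>insert x D. \<sigma> y = \<tau> y"
    then have "cyl L \<sigma> = cyl L \<tau>" if "L \<subseteq> insert x D" for L
      using that by (intro cyl_cong) auto
    from this[of "insert x C"] this[of C] this[of D] this[of "insert x D"] sub
    have "cyl (insert x C) \<sigma> = cyl (insert x C) \<tau>" "cyl C \<sigma> = cyl C \<tau>" "cyl D \<sigma> = cyl D \<tau>"
      "cyl (insert x D) \<sigma> = cyl (insert x D) \<tau>" by blast+
    then show "?f \<sigma> = ?f \<tau>" by (simp only:)
  qed
  have "(\<integral>\<omega>. ?f \<omega> \<partial>\<mu>) = (\<Sum>\<sigma>\<in>?P. ?m (insert x D) \<sigma> * ?f \<sigma>)"
    using fin by (intro integral_depends_on(2)[OF p _ dep]) simp
  also have "\<dots> \<le> (\<Sum>\<sigma>\<in>?P. ?m (insert x C) \<sigma> * ?m D \<sigma> / ?m C \<sigma> - ?m (insert x D) \<sigma>)"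
  proof (rule sum_mono)
    fix \<sigma> :: "('d, 'e) config"
    show "?m (insert x D) \<sigma> * ?f \<sigma> \<le> ?m (insert x C) \<sigma> * ?m D \<sigma> / ?m C \<sigma> - ?m (insert x D) \<sigma>"
    \<comment> \<open>On a null cylinder the weight kills the logarithms, whatever value they take
      there, and the right-hand side is nonnegative. Otherwise all four cylinders have positive mass
      and \<open>?f\<close> is a genuine log ratio.\<close>
    proof (cases "?m (insert x D) \<sigma> = 0")
      case True
      then show ?thesis by simp
    next
      case False
      then have p4: "?m (insert x D) \<sigma> > 0" by (simp add: zero_less_measure_iff)
      have p1: "?m (insert x C) \<sigma> > 0"
        using p4 mono[OF Set.insert_mono[OF sub], of x \<sigma>] fin by simp
      have p2: "?m D \<sigma> > 0" using p4 mono[OF subset_insertI[of D x], of \<sigma>] fin by simp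
      have p3: "?m C \<sigma> > 0" using p2 mono[OF sub fin, of \<sigma>] by simp
      let ?r = "?m (insert x C) \<sigma> * ?m D \<sigma> / ?m C \<sigma> / ?m (insert x D) \<sigma>"
      have "?f \<sigma> = ln ?r" using p1 p2 p3 p4 by (simp add: ln_mult ln_div)
      also have "\<dots> \<le> ?r - 1" using p1 p2 p3 p4 by (intro ln_le_minus_one) simp
      finally have "?m (insert x D) \<sigma> * ?f \<sigma> \<le> ?m (insert x D) \<sigma> * (?r - 1)"
        using p4 by (intro mult_left_mono) auto
      also have "\<dots> = ?m (insert x C) \<sigma> * ?m D \<sigma> / ?m C \<sigma> - ?m (insert x D) \<sigma>"
        using False by (simp add: right_diff_distrib)
      finally show ?thesis .
    qed
  qed
  also have "\<dots> = (\<Sum>\<sigma>\<in>?P. ?m (insert x C) \<sigma> * ?m D \<sigma> / ?m C \<sigma>) - 1"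
    using sum_measure_cyl[OF p, of "insert x D"] fin by (simp add: sum_subtractf)
  also have "(\<Sum>\<sigma>\<in>?P. ?m (insert x C) \<sigma> * ?m D \<sigma> / ?m C \<sigma>) \<le> 1"
  proof -
    have upd: "cyl L (\<sigma>(x := s)) = cyl L \<sigma>" if "x \<notin> L" for L s and \<sigma> :: "('d, 'e) config"
      using that by (intro cyl_cong) auto
    have "(\<Sum>\<sigma>\<in>?P. ?m (insert x C) \<sigma> * ?m D \<sigma> / ?m C \<sigma>)
        = (\<Sum>\<sigma>\<in>PiE D (\<lambda>_. UNIV). (\<Sum>s\<in>UNIV. ?m (insert x C) (\<sigma>(x := s))) * (?m D \<sigma> / ?m C \<sigma>))"
      unfolding sum_PiE_insert[OF x] by (simp add: upd x xC sum_distrib_right sum_divide_distrib)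
    also have "\<dots> = (\<Sum>\<sigma>\<in>PiE D (\<lambda>_. UNIV). ?m C \<sigma> * (?m D \<sigma> / ?m C \<sigma>))"
      by (simp add: sum_measure_cyl_insert[OF p finC xC])
    \<comment> \<open>Only an inequality is claimed: where \<open>?m C \<sigma> = 0\<close>,
      division by zero makes the left term 0.\<close>
    also have "\<dots> \<le> (\<Sum>\<sigma>\<in>PiE D (\<lambda>_. UNIV). ?m D \<sigma>)"
      by (intro sum_mono) simp
    also have "\<dots> = 1" by (rule sum_measure_cyl[OF p fin])
    finally show ?thesis .
  qed
  finally have "(\<integral>\<omega>. ?f \<omega> \<partial>\<mu>) \<le> 0" by simp
  moreover have "(\<integral>\<omega>. ?f \<omega> \<partial>\<mu>) = - block_entropy \<mu> (insert x C) - block_entropy \<mu> D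
      + block_entropy \<mu> C + block_entropy \<mu> (insert x D)"
    unfolding block_entropy_def using fin finC
    by (simp add: Bochner_Integration.integral_add Bochner_Integration.integral_diff
        Bochner_Integration.integrable_add Bochner_Integration.integrable_diff integrable_ln_cyl[OF p])
  ultimately show ?thesis by linarith
qed

text \<open>Adding a site shrinks the cylinder, so the log ratio is nonnegative wherever the weight
  is positive. This nonnegativity of conditional entropies makes the infimum in the entropy density
  finite.\<close>

lemma block_entropy_mono_insert:
  fixes \<mu> :: "('d::finite, 'e::finite) config measure"
  assumes p: "prob_on_Omega \<mu>" and fin: "finite L"
  shows "block_entropy \<mu> L \<le> block_entropy \<mu> (insert x L)"
proof -
  interpret prob_space \<mu> by (rule prob_on_Omega_D(1)[OF p])
  let ?m = "\<lambda>L \<sigma>. measure \<mu> (cyl L \<sigma>)"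
  let ?f = "\<lambda>\<sigma>. ln (?m L \<sigma>) - ln (?m (insert x L) \<sigma>)"
  have dep: "depends_on (insert x L) ?f"
    unfolding depends_on_def by (metis cyl_cong insertCI)
  have "0 \<le> (\<Sum>\<sigma>\<in>PiE (insert x L) (\<lambda>_. UNIV). ?m (insert x L) \<sigma> * ?f \<sigma>)"
  proof (rule sum_nonneg)
    fix \<sigma> :: "('d, 'e) config"
    have "cyl L \<sigma> \<in> sets \<mu>" using fin prob_on_Omega_D(2)[OF p] by simp
    then have "?m (insert x L) \<sigma> \<le> ?m L \<sigma>" by (intro finite_measure_mono cyl_mono) auto
    then show "0 \<le> ?m (insert x L) \<sigma> * ?f \<sigma>"
    proof (cases "?m (insert x L) \<sigma> = 0")
      case False
      then have "?m (insert x L) \<sigma> > 0" by (simp add: zero_less_measure_iff)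
      then have "ln (?m (insert x L) \<sigma>) \<le> ln (?m L \<sigma>)" using \<open>_ \<le> _\<close> by simp
      then show ?thesis by simp
    qed simp
  qed
  also have "\<dots> = (\<integral>\<omega>. ?f \<omega> \<partial>\<mu>)"
    using fin by (intro integral_depends_on(2)[OF p _ dep, symmetric]) simp
  also have "\<dots> = block_entropy \<mu> (insert x L) - block_entropy \<mu> L"
    unfolding block_entropy_def using fin
    by (simp add: Bochner_Integration.integral_diff integrable_ln_cyl[OF p])
  finally show ?thesis by simp
qed

lemma translate_lex_below:
  "(\<lambda>z. z - x) ` {y \<in> L. y = x \<or> lex_less y x}
    = {y \<in> (\<lambda>z. z - x) ` L. y = 0 \<or> lex_less y 0}"
  "(\<lambda>z. z - x) ` {y \<in> L. lex_less y x} = {y \<in> (\<lambda>z. z - x) ` L. lex_less y 0}"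
  using lex_less_diff by auto

text \<open>The conditional entropies are nonnegative and decrease in the window, so their infimum
  is a limit along all large finite windows, not just cubes. That is the form needed for averaging,
  since the cube seen from one of its sites is not centred.\<close>

lemma convergent_ent_seq_self:
  fixes \<mu> :: "('d::{finite,linorder}, 'e::finite) config measure"
  assumes inv: "inv_prob \<mu>"
  shows "convergent (ent_seq \<mu> \<mu>)"
proof -
  have p: "prob_on_Omega \<mu>" using inv by (simp add: inv_prob_def)
  let ?H = "block_entropy \<mu>"
  \<comment> \<open>\<open>G L\<close> is the conditional entropy of the spin at the origin given
    the part of its lexicographic past inside \<open>L\<close>, provided that
    \<open>0 \<in> L\<close>.\<close>
  define G where "G L = ?H {y \<in> L. y = 0 \<or> lex_less y 0} - ?H {y \<in> L. lex_less y 0}" for L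
  have ins: "{y \<in> L. y = 0 \<or> lex_less y 0} = insert 0 {y \<in> L. lex_less y 0}"
    if "0 \<in> L" for L :: "(int, 'd) vec set"
    using that by auto
  have nonneg: "0 \<le> G L" if "finite L" "0 \<in> L" for L
    using block_entropy_mono_insert[OF p, of "{y \<in> L. lex_less y 0}" 0] that by (simp add: G_def ins)
  have anti: "G L' \<le> G L" if "finite L'" "L \<subseteq> L'" "0 \<in> L" for L L'
  proof -
    have "0 \<in> L'" using that by auto
    then show ?thesis
      using block_entropy_increment_antimono[OF p, of "{y \<in> L'. lex_less y 0}" "{y \<in> L. lex_less y 0}" 0] that
      by (auto simp: G_def ins lex_less_irrefl)
  qed
  define c where "c = Inf (G ` {L. finite L \<and> 0 \<in> L})"
  have ne: "G ` {L. finite L \<and> 0 \<in> L} \<noteq> {}" by (auto intro!: exI[of _ "{0}"])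
  have bdd: "bdd_below (G ` {L. finite L \<and> 0 \<in> L})" using nonneg by (intro bdd_belowI[of _ 0]) auto
  have "(\<lambda>n. (\<Sum>x\<in>cube n. G ((\<lambda>y. y - x) ` cube n)) / real (card (cube n :: (int, 'd) vec set)))
    \<longlonglongrightarrow> c"
  proof (rule cube_average_tendsto)
    fix L :: "(int, 'd) vec set" assume "finite L" "0 \<in> L"
    then show "\<bar>G L\<bar> \<le> G {0}" using nonneg[of L] anti[of L "{0}"] by auto
  next
    fix e :: real assume "e > 0"
    then obtain M where M: "finite M" "0 \<in> M" "G M < c + e"
      using cInf_lessD[OF ne, of "c + e"] by (auto simp: c_def)
    obtain m where m: "M \<subseteq> cube m" using finite_subset_cube[OF M(1)] ..
    have "\<bar>G L - c\<bar> \<le> e" if L: "finite L" "cube m \<subseteq> L" for L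
    proof -
      have "G L \<le> G M" using L m M by (intro anti) auto
      moreover have "c \<le> G L"
        unfolding c_def using L zero_in_cube[of m] by (intro cInf_lower[OF _ bdd] imageI) blast
      ultimately show ?thesis using M(3) by simp
    qed
    then show "\<exists>m. \<forall>L. finite L \<and> cube m \<subseteq> L \<longrightarrow> \<bar>G L - c\<bar> \<le> e" by blast
  qed
  moreover have "(\<Sum>x\<in>cube n. G ((\<lambda>y. y - x) ` cube n)) / real (card (cube n :: (int, 'd) vec set))
      = ent_seq \<mu> \<mu> n" for n
  proof -
    have "(\<Sum>x\<in>cube n. G ((\<lambda>y. y - x) ` cube n))
        = (\<Sum>x\<in>cube n. ?H {y \<in> cube n. y = x \<or> lex_less y x} - ?H {y \<in> cube n. lex_less y x})"
      by (simp add: G_def translate_lex_below[symmetric] block_entropy_translate[OF inv])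
    also have "\<dots> = ?H (cube n) - ?H {}" by (rule sum_telescope_lex[OF finite_cube])
    finally show ?thesis
      by (simp add: block_entropy_empty[OF p]) (simp add: ent_seq_def block_entropy_def)
  qed
  ultimately show ?thesis by (auto simp: convergent_def)
qed

subsection \<open>Single-site conditional probabilities\<close>

text \<open>A level set of \<open>f\<close> is a preimage under restriction to \<open>L\<close>,
  hence contains with \<sigma> every configuration agreeing with it on \<open>L\<close>. No
  finiteness of \<open>L\<close> enters, and \<open>L\<close> is the complement of the origin
  below.\<close>

lemma depends_on_F_alg:
  fixes f :: "('d::finite, 'e) config \<Rightarrow> real"
  assumes "f \<in> borel_measurable (F_alg L)"
  shows "depends_on L f"
  unfolding depends_on_def
proof (intro allI impI)
  fix \<sigma> \<tau> :: "('d, 'e) config"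
  assume eq: "\<forall>x\<in>L. \<sigma> x = \<tau> x"
  have "f -` {f \<sigma>} \<inter> space (F_alg L) \<in> sets (F_alg L)"
    by (rule measurable_sets[OF assms]) simp
  moreover have "sets (F_alg L :: ('d, 'e) config measure)
      = {(\<lambda>\<omega>. restrict \<omega> L) -` A \<inter> space Omega |A. A \<in> sets (PiM L (\<lambda>_. count_space UNIV))}"
    unfolding F_alg_def by (rule sets_vimage_algebra2) (auto simp: space_PiM)
  ultimately obtain A where A: "f -` {f \<sigma>} = (\<lambda>\<omega>. restrict \<omega> L) -` A"
    by (auto simp: F_alg_def)
  have "restrict \<sigma> L = restrict \<tau> L" using eq by (auto simp: restrict_def)
  moreover have "\<sigma> \<in> f -` {f \<sigma>}" by simp
  ultimately have "\<tau> \<in> f -` {f \<sigma>}" unfolding A by simp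
  then show "f \<sigma> = f \<tau>" by simp
qed

lemma cyl_F_alg:
  fixes \<sigma> :: "('d::finite, 'e) config"
  assumes "finite K" "K \<subseteq> L"
  shows "cyl K \<sigma> \<in> sets (F_alg L)"
proof -
  let ?M = "PiM L (\<lambda>_. count_space UNIV)"
  have "{\<eta> \<in> space ?M. \<forall>x\<in>K. \<eta> x = \<sigma> x} \<in> sets ?M" if "K \<noteq> {}"
  proof (rule sets.sets_Collect_finite_All'[OF _ assms(1) that])
    fix x assume "x \<in> K"
    then have "(\<lambda>\<eta>. \<eta> x) -` {\<sigma> x} \<inter> space ?M \<in> sets ?M"
      using assms(2) by (intro measurable_sets[OF measurable_component_singleton]) auto
    then show "{\<eta> \<in> space ?M. \<eta> x = \<sigma> x} \<in> sets ?M"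
      by (simp add: vimage_def Int_def conj_commute)
  qed
  then have "{\<eta> \<in> space ?M. \<forall>x\<in>K. \<eta> x = \<sigma> x} \<in> sets ?M" by (cases "K = {}") auto
  from in_vimage_algebra[OF this, of "\<lambda>\<omega>. restrict \<omega> L" "space Omega"]
  have "(\<lambda>\<omega>. restrict \<omega> L) -` {\<eta> \<in> space ?M. \<forall>x\<in>K. \<eta> x = \<sigma> x} \<inter> space Omega \<in> sets (F_alg L)"
    by (simp add: F_alg_def)
  moreover have "(\<lambda>\<omega>. restrict \<omega> L) -` {\<eta> \<in> space ?M. \<forall>x\<in>K. \<eta> x = \<sigma> x} \<inter> space Omega = cyl K \<sigma>"
  proof (rule set_eqI)
    fix \<omega> :: "('d, 'e) config"
    have "restrict \<omega> L \<in> space ?M" by (simp add: space_PiM)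
    moreover have "(\<forall>x\<in>K. restrict \<omega> L x = \<sigma> x) \<longleftrightarrow> (\<forall>x\<in>K. \<omega> x = \<sigma> x)"
      using assms(2) by (intro ball_cong) auto
    ultimately show "\<omega> \<in> (\<lambda>\<omega>. restrict \<omega> L) -` {\<eta> \<in> space ?M. \<forall>x\<in>K. \<eta> x = \<sigma> x} \<inter> space Omega
        \<longleftrightarrow> \<omega> \<in> cyl K \<sigma>"
      by (simp add: cyl_def)
  qed
  ultimately show ?thesis by simp
qed

lemma F_alg_measurable_Omega:
  assumes "f \<in> measurable (F_alg L) N"
  shows "f \<in> measurable Omega N"
proof -
  have "(\<lambda>\<omega>. \<omega>) \<in> measurable Omega (F_alg L)"
    unfolding F_alg_def
    by (rule measurable_vimage_algebra2) (auto simp: Omega_def intro!: measurable_restrict_subset)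
  from measurable_compose[OF this assms] show ?thesis .
qed

text \<open>The kernel at the origin suffices, because invariance of the measures moves every other
  site there.\<close>

definition site_prob ::
  "(((int, 'd::finite) vec) set \<Rightarrow> ('d, 'e) config \<Rightarrow> ('d, 'e) config measure) \<Rightarrow> 'e \<Rightarrow> ('d, 'e) config \<Rightarrow> real"
  where "site_prob \<gamma> s \<eta> = measure (\<gamma> {0} \<eta>) (cyl {0} (\<lambda>_. s))"

lemma is_spec_D:
  assumes "is_spec \<gamma>" "finite L"
  shows "prob_space (\<gamma> L \<omega>)" "sets (\<gamma> L \<omega>) = sets Omega"
    and "A \<in> sets Omega \<Longrightarrow> (\<lambda>\<omega>. measure (\<gamma> L \<omega>) A) \<in> borel_measurable (F_alg (- L))"
  using assms by (simp_all add: is_spec_def)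

lemma site_prob_F_alg:
  assumes "is_spec \<gamma>"
  shows "site_prob \<gamma> s \<in> borel_measurable (F_alg (- {0}))"
  unfolding site_prob_def[abs_def] by (intro is_spec_D(3)[OF assms]) auto

lemma site_prob_le_1:
  assumes "is_spec \<gamma>"
  shows "site_prob \<gamma> s \<eta> \<le> 1"
  unfolding site_prob_def by (intro prob_space.prob_le_1 is_spec_D(1)[OF assms]) simp

lemma site_prob_upd:
  assumes "is_spec \<gamma>"
  shows "site_prob \<gamma> s (\<eta>(0 := t)) = site_prob \<gamma> s \<eta>"
  using depends_on_F_alg[OF site_prob_F_alg[OF assms]] unfolding depends_on_def by auto

text \<open>A basic neighbourhood in the product topology constrains finitely many sites, and these
  fit into a cube. The local function tested is the indicator of the spin at the origin.\<close>

lemma Omega_gamma_site_prob_continuous: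
  fixes \<gamma> :: "((int, 'd::finite) vec) set \<Rightarrow> ('d, 'e) config \<Rightarrow> ('d, 'e) config measure"
  assumes spec: "is_spec \<gamma>" and \<omega>: "\<omega> \<in> Omega_gamma \<gamma>" and e: "e > 0"
  shows "\<exists>m. \<forall>\<eta>. (\<forall>y\<in>cube m - {0}. \<eta> y = \<omega> y) \<longrightarrow> \<bar>site_prob \<gamma> s \<eta> - site_prob \<gamma> s \<omega>\<bar> \<le> e"
proof -
  let ?A = "cyl {0} (\<lambda>_. s) :: ('d, 'e) config set"
  have loc: "local_fun (indicator ?A)"
    unfolding local_fun_def by (intro exI[of _ "{0}"] conjI borel_measurable_indicator cyl_F_alg) auto
  have int: "(\<integral>\<eta>. indicator ?A \<eta> \<partial>\<gamma> {0} \<omega>') = site_prob \<gamma> s \<omega>'" for \<omega>'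
  proof -
    have s: "sets (\<gamma> {0} \<omega>') = sets Omega" by (intro is_spec_D(2)[OF spec]) simp
    then have "space (\<gamma> {0} \<omega>') = UNIV" using sets_eq_imp_space_eq[OF s] by simp
    then show ?thesis by (simp add: site_prob_def)
  qed
  have "limitin euclideanreal (\<lambda>\<omega>'. \<integral>\<eta>. indicator ?A \<eta> \<partial>\<gamma> {0} \<omega>')
      (\<integral>\<eta>. indicator ?A \<eta> \<partial>\<gamma> {0} \<omega>) (atin config_topology \<omega>)"
    using \<omega>[unfolded Omega_gamma_def, THEN CollectD, THEN HOL.spec, THEN HOL.spec, THEN mp, OF conjI, OF _ loc] by simp
  then have "((\<lambda>\<omega>'. site_prob \<gamma> s \<omega>') \<longlongrightarrow> site_prob \<gamma> s \<omega>) (atin config_topology \<omega>)"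
    unfolding int by (simp add: limitin_canonical_iff)
  then have "\<forall>\<^sub>F \<eta> in atin config_topology \<omega>. dist (site_prob \<gamma> s \<eta>) (site_prob \<gamma> s \<omega>) < e"
    using e by (rule tendstoD)
  moreover have "\<omega> \<in> topspace config_topology"
    by (simp add: config_topology_def)
  ultimately obtain U where U: "openin config_topology U" "\<omega> \<in> U"
      "\<forall>\<eta>\<in>U - {\<omega>}. dist (site_prob \<gamma> s \<eta>) (site_prob \<gamma> s \<omega>) < e"
    unfolding eventually_atin by blast
  from U(1,2) obtain V where V: "finite {i. V i \<noteq> (UNIV :: 'e set)}" "\<omega> \<in> PiE UNIV V" "PiE UNIV V \<subseteq> U"
    unfolding config_topology_def openin_product_topology_alt by auto
  obtain m where m: "{i. V i \<noteq> UNIV} \<subseteq> cube m" using finite_subset_cube[OF V(1)] ..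
  have "\<bar>site_prob \<gamma> s \<eta> - site_prob \<gamma> s \<omega>\<bar> \<le> e" if \<eta>: "\<forall>y\<in>cube m - {0}. \<eta> y = \<omega> y" for \<eta>
  proof -
    \<comment> \<open>The neighbourhood may constrain the origin, where \<eta> is free. Resetting
      that spin leaves \<open>site_prob\<close> unchanged. The result may be \<omega> itself, which
      the punctured filter \<open>atin\<close> does not cover, hence the case split below.\<close>
    let ?\<eta> = "\<eta>(0 := \<omega> 0)"
    have "?\<eta> i \<in> V i" for i
    proof (cases "V i = UNIV")
      case False
      then have "i \<in> cube m" using m by auto
      then have "?\<eta> i = \<omega> i" using \<eta> by auto
      then show ?thesis using V(2) by auto
    qed simp
    then have "?\<eta> \<in> U" using V(3) by auto
    then have "dist (site_prob \<gamma> s ?\<eta>) (site_prob \<gamma> s \<omega>) < e"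
      using U(3) e by (cases "?\<eta> = \<omega>") auto
    then show ?thesis by (simp add: site_prob_upd[OF spec] dist_real_def)
  qed
  then show ?thesis by blast
qed

lemma nonnull_D:
  assumes "nonnull \<gamma>" "finite L" "L \<noteq> {}"
  obtains a where "0 < a" "\<And>\<sigma> \<eta>. a \<le> measure (\<gamma> L \<eta>) (cyl L \<sigma>)"
proof -
  from assms obtain a b where "0 < a \<and> b < 1 \<and>
      (\<forall>\<sigma> \<eta>. a \<le> measure (\<gamma> L \<eta>) (cyl L \<sigma>) \<and> measure (\<gamma> L \<eta>) (cyl L \<sigma>) \<le> b)"
    unfolding nonnull_def by meson
  then show thesis by (intro that[of a]) simp_all
qed

section \<open>Gibbs measures of cylinders\<close>

lemma Gibbs_D:
  assumes "Gibbs \<gamma> \<mu>" "finite L" "A \<in> sets Omega" "B \<in> sets (F_alg (- L))"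
  shows "measure \<mu> (A \<inter> B) = (\<integral>\<omega>. indicator B \<omega> * measure (\<gamma> L \<omega>) A \<partial>\<mu>)"
  using assms by (simp add: Gibbs_def)

lemma Gibbs_cyl_eq:
  assumes "Gibbs \<gamma> \<nu>" "finite L" "0 \<in> L"
  shows "measure \<nu> (cyl L \<omega>) = (\<integral>\<eta>. indicator (cyl (L - {0}) \<omega>) \<eta> * site_prob \<gamma> (\<omega> 0) \<eta> \<partial>\<nu>)"
proof -
  have "cyl L \<omega> = cyl {0} (\<lambda>_. \<omega> 0) \<inter> cyl (L - {0}) \<omega>"
    using assms(3) unfolding cyl_def by blast
  moreover have "cyl (L - {0}) \<omega> \<in> sets (F_alg (- {0}))"
    using assms(2) by (intro cyl_F_alg) auto
  ultimately show ?thesis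
    using Gibbs_D[OF assms(1), of "{0}" "cyl {0} (\<lambda>_. \<omega> 0)" "cyl (L - {0}) \<omega>"] by (simp add: site_prob_def)
qed

text \<open>The mass of the cylinder is the integral of \<open>site_prob\<close> over the cylinder
  without the origin, so bounds valid there carry over to any Gibbs measure. The product form avoids
  dividing by a mass not yet known to be positive.\<close>

lemma Gibbs_cyl_bounds:
  fixes \<nu> :: "('d::finite, 'e) config measure"
  assumes spec: "is_spec \<gamma>" and G: "Gibbs \<gamma> \<nu>" and L: "finite L" "0 \<in> L"
    and bounds: "\<And>\<eta>. \<eta> \<in> cyl (L - {0}) \<omega> \<Longrightarrow> l \<le> site_prob \<gamma> (\<omega> 0) \<eta> \<and> site_prob \<gamma> (\<omega> 0) \<eta> \<le> u"
  shows "l * measure \<nu> (cyl (L - {0}) \<omega>) \<le> measure \<nu> (cyl L \<omega>)"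
    and "measure \<nu> (cyl L \<omega>) \<le> u * measure \<nu> (cyl (L - {0}) \<omega>)"
proof -
  have p: "prob_on_Omega \<nu>" using G by (simp add: Gibbs_def)
  interpret prob_space \<nu> by (rule prob_on_Omega_D(1)[OF p])
  let ?A = "cyl (L - {0}) \<omega>"
  have A: "?A \<in> sets \<nu>" using L prob_on_Omega_D(2)[OF p] by simp
  have meas: "site_prob \<gamma> (\<omega> 0) \<in> borel_measurable \<nu>"
    using F_alg_measurable_Omega[OF site_prob_F_alg[OF spec]]
      measurable_cong_sets[OF prob_on_Omega_D(2)[OF p] refl] by blast
  have int: "integrable \<nu> (\<lambda>\<eta>. indicator ?A \<eta> * site_prob \<gamma> (\<omega> 0) \<eta>)"
  proof (rule integrable_const_bound[of _ 1])
    show "(\<lambda>\<eta>. indicator ?A \<eta> * site_prob \<gamma> (\<omega> 0) \<eta>) \<in> borel_measurable \<nu>"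
      using A meas by (intro borel_measurable_times borel_measurable_indicator)
    show "AE \<eta> in \<nu>. norm (indicator ?A \<eta> * site_prob \<gamma> (\<omega> 0) \<eta>) \<le> 1"
      using site_prob_le_1[OF spec, of "\<omega> 0"] by (auto simp: indicator_def site_prob_def)
  qed
  have intc: "integrable \<nu> (\<lambda>\<eta>. indicator ?A \<eta> * k)" for k :: real
    using A by (intro integrable_mult_left integrable_real_indicator) (auto simp: emeasure_eq_measure)
  have c: "(\<integral>\<eta>. indicator ?A \<eta> * k \<partial>\<nu>) = k * measure \<nu> ?A" for k :: real
    using A prob_on_Omega_D(3)[OF p] by simp
  have "(\<integral>\<eta>. indicator ?A \<eta> * l \<partial>\<nu>) \<le> (\<integral>\<eta>. indicator ?A \<eta> * site_prob \<gamma> (\<omega> 0) \<eta> \<partial>\<nu>)"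
    using bounds by (intro integral_mono int intc) (auto simp: indicator_def)
  then show "l * measure \<nu> ?A \<le> measure \<nu> (cyl L \<omega>)"
    by (simp only: c Gibbs_cyl_eq[OF G L])
  have "(\<integral>\<eta>. indicator ?A \<eta> * site_prob \<gamma> (\<omega> 0) \<eta> \<partial>\<nu>) \<le> (\<integral>\<eta>. indicator ?A \<eta> * u \<partial>\<nu>)"
    using bounds by (intro integral_mono int intc) (auto simp: indicator_def)
  then show "measure \<nu> (cyl L \<omega>) \<le> u * measure \<nu> ?A"
    by (simp only: c Gibbs_cyl_eq[OF G L])
qed

text \<open>The nonnull lower bound of the kernel on \<open>L\<close> survives integration against
  \<nu>. Positivity makes every later logarithm of a Gibbs mass genuine.\<close>

lemma Gibbs_cyl_pos:
  fixes \<nu> :: "('d::finite, 'e) config measure"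
  assumes spec: "is_spec \<gamma>" and nn: "nonnull \<gamma>" and G: "Gibbs \<gamma> \<nu>" and L: "finite L"
  shows "measure \<nu> (cyl L \<omega>) > 0"
proof -
  have p: "prob_on_Omega \<nu>" using G by (simp add: Gibbs_def)
  interpret prob_space \<nu> by (rule prob_on_Omega_D(1)[OF p])
  show ?thesis
  proof (cases "L = {}")
    case True
    then show ?thesis using prob_space prob_on_Omega_D(3)[OF p] by simp
  next
    case False
    then obtain a where a: "a > 0" "\<And>\<sigma> \<eta>. a \<le> measure (\<gamma> L \<eta>) (cyl L \<sigma>)"
      using nonnull_D[OF nn L] by metis
    have meas: "(\<lambda>\<eta>. measure (\<gamma> L \<eta>) (cyl L \<omega>)) \<in> borel_measurable \<nu>"
      using F_alg_measurable_Omega[OF is_spec_D(3)[OF spec L cyl_sets[OF L]]]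
        measurable_cong_sets[OF prob_on_Omega_D(2)[OF p] refl] by blast
    have int: "integrable \<nu> (\<lambda>\<eta>. measure (\<gamma> L \<eta>) (cyl L \<omega>))"
      by (rule integrable_const_bound[of _ 1, OF _ meas]) (simp add: prob_space.prob_le_1[OF is_spec_D(1)[OF spec L]])
    \<comment> \<open>The whole space, written as a cylinder, is the conditioning event.\<close>
    have "cyl {} \<omega> \<in> sets (F_alg (- L))" by (rule cyl_F_alg) auto
    from Gibbs_D[OF G L cyl_sets[OF L] this] have "measure \<nu> (cyl L \<omega>) = (\<integral>\<eta>. measure (\<gamma> L \<eta>) (cyl L \<omega>) \<partial>\<nu>)" by simp
    also have "\<dots> \<ge> (\<integral>\<eta>. a \<partial>\<nu>)" by (intro integral_mono int) (auto simp: a)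
    finally show ?thesis using a(1) by (simp add: prob_space)
  qed
qed

text \<open>Here the Gibbs measure disappears: once the window contains the cube given by
  continuity, the conditional probability is squeezed around a value of \<open>\<gamma>\<close>
  alone. The spin \<open>t\<close> is free because \<omega> matters only off the origin.\<close>

lemma Gibbs_cyl_ratio_tendsto:
  fixes \<nu> :: "('d::finite, 'e) config measure"
  assumes spec: "is_spec \<gamma>" and nn: "nonnull \<gamma>" and G: "Gibbs \<gamma> \<nu>" and \<omega>: "\<omega> \<in> Omega_gamma \<gamma>"
    and L: "\<And>m. finite (L m)" "\<And>m. cube m \<subseteq> L m"
  shows "(\<lambda>m. measure \<nu> (cyl (L m) (\<omega> (0 := t))) / measure \<nu> (cyl (L m - {0}) \<omega>))
    \<longlonglongrightarrow> site_prob \<gamma> t \<omega>"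
proof (rule LIMSEQ_I)
  fix r :: real assume r: "r > 0"
  let ?q = "site_prob \<gamma> t \<omega>"
  obtain k where k: "\<And>\<eta>. (\<forall>y\<in>cube k - {0}. \<eta> y = \<omega> y) \<Longrightarrow> \<bar>site_prob \<gamma> t \<eta> - ?q\<bar> \<le> r / 2"
    using Omega_gamma_site_prob_continuous[OF spec \<omega>, of "r / 2" t] r by auto
  have "norm (measure \<nu> (cyl (L m) (\<omega> (0 := t))) / measure \<nu> (cyl (L m - {0}) \<omega>) - ?q) < r" if "m \<ge> k" for m
  proof -
    let ?A = "cyl (L m - {0}) \<omega>"
    have A: "cyl (L m - {0}) (\<omega> (0 := t)) = ?A" by (rule cyl_cong) auto
    have pos: "measure \<nu> ?A > 0" using L(1) by (intro Gibbs_cyl_pos[OF spec nn G]) simp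
    have sub: "cube k \<subseteq> L m" using cube_mono[OF that] L(2)[of m] by blast
    have b: "?q - r / 2 \<le> site_prob \<gamma> ((\<omega> (0 := t)) 0) \<eta> \<and> site_prob \<gamma> ((\<omega> (0 := t)) 0) \<eta> \<le> ?q + r / 2"
      if "\<eta> \<in> cyl (L m - {0}) (\<omega> (0 := t))" for \<eta>
    proof -
      have "\<forall>y\<in>cube k - {0}. \<eta> y = \<omega> y" using that sub unfolding A by (auto simp: cyl_def)
      from k[OF this] have "site_prob \<gamma> t \<eta> - ?q \<le> r / 2" "- (site_prob \<gamma> t \<eta> - ?q) \<le> r / 2"
        by (auto simp only: abs_le_iff)
      then show ?thesis by simp
    qed
    have z: "0 \<in> L m" using sub zero_in_cube[of k] by blast
    note bb = Gibbs_cyl_bounds[OF spec G L(1) z, of "\<omega> (0 := t)" "?q - r / 2" "?q + r / 2", OF b, unfolded A]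
    have "?q - r / 2 \<le> measure \<nu> (cyl (L m) (\<omega> (0 := t))) / measure \<nu> ?A"
      "measure \<nu> (cyl (L m) (\<omega> (0 := t))) / measure \<nu> ?A \<le> ?q + r / 2"
      using bb pos by (simp_all add: pos_le_divide_eq pos_divide_le_eq)
    then show ?thesis using r by (simp add: abs_less_iff)
  qed
  then show "\<exists>no. \<forall>n\<ge>no. norm (measure \<nu> (cyl (L n) (\<omega> (0 := t))) / measure \<nu> (cyl (L n - {0}) \<omega>) - ?q) < r"
    by blast
qed

subsection \<open>Telescoping along the lexicographic order\<close>

text \<open>The cost of the telescoping step at the origin: \<open>\<sigma>\<close> is already in place before the origin,
  \<open>\<xi>\<close> is still there after it, and the pair is \<open>(\<xi>, \<sigma>)\<close>.\<close>

definition log_gap :: "('d::{finite,linorder}, 'e) config measure \<Rightarrow> (int, 'd) vec set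
    \<Rightarrow> ('d, 'e) config \<times> ('d, 'e) config \<Rightarrow> real" where
  "log_gap \<nu> L p = ln (measure \<nu> (cyl L (glue (snd p) (fst p))))
     - ln (measure \<nu> (cyl L ((glue (snd p) (fst p))(0 := fst p 0))))"

text \<open>Both terms have the same boundary condition, so a single membership of the glued
  configuration in \<open>Omega_gamma\<close> controls them.\<close>

definition log_gap_limit :: "((int, 'd::{finite,linorder}) vec set \<Rightarrow> ('d, 'e) config \<Rightarrow> ('d, 'e) config measure)
    \<Rightarrow> ('d, 'e) config \<times> ('d, 'e) config \<Rightarrow> real" where
  "log_gap_limit \<gamma> p = ln (site_prob \<gamma> (glue (snd p) (fst p) 0) (glue (snd p) (fst p)))
     - ln (site_prob \<gamma> (fst p 0) (glue (snd p) (fst p)))"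

text \<open>\<open>T S\<close> carries \<sigma> on \<open>S\<close> and \<xi> elsewhere; letting
  \<open>S\<close> grow through the initial segments of \<open>L\<close> replaces one spin at a
  time, and each step is then shifted to the origin.\<close>

lemma ln_cyl_telescope:
  fixes \<nu> :: "('d::{finite,linorder}, 'e) config measure"
  assumes inv: "inv_prob \<nu>" and L: "finite L"
  shows "ln (measure \<nu> (cyl L \<sigma>)) - ln (measure \<nu> (cyl L \<xi>))
    = (\<Sum>x\<in>L. log_gap \<nu> ((\<lambda>y. y - x) ` L) (shift x \<xi>, shift x \<sigma>))"
proof -
  define T where "T S = (\<lambda>y. if y \<in> S then \<sigma> y else \<xi> y)" for S
  define F where "F S = ln (measure \<nu> (cyl L (T S)))" for S
  have "log_gap \<nu> ((\<lambda>y. y - x) ` L) (shift x \<xi>, shift x \<sigma>)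
      = F {y \<in> L. y = x \<or> lex_less y x} - F {y \<in> L. lex_less y x}" for x
  proof -
    have lex: "lex_less (y - x) 0 \<longleftrightarrow> lex_less y x" for y by (rule lex_less_diff)
    \<comment> \<open>The two configurations may differ outside the window, where \<open>T\<close>
      keeps \<xi> even in the past of \<open>x\<close>; the cylinder does not see this.\<close>
    have "cyl ((\<lambda>y. y - x) ` L) (glue (shift x \<sigma>) (shift x \<xi>))
        = cyl ((\<lambda>y. y - x) ` L) (shift x (T {y \<in> L. y = x \<or> lex_less y x}))"
      by (rule cyl_cong) (auto simp: glue_def shift_def T_def lex)
    moreover have "cyl ((\<lambda>y. y - x) ` L) ((glue (shift x \<sigma>) (shift x \<xi>))(0 := shift x \<xi> 0))
        = cyl ((\<lambda>y. y - x) ` L) (shift x (T {y \<in> L. lex_less y x}))"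
      by (rule cyl_cong) (auto simp: glue_def shift_def T_def lex lex_less_irrefl)
    ultimately show ?thesis
      by (simp add: log_gap_def F_def measure_cyl_shift[OF inv L])
  qed
  then have "(\<Sum>x\<in>L. log_gap \<nu> ((\<lambda>y. y - x) ` L) (shift x \<xi>, shift x \<sigma>)) = F L - F {}"
    using sum_telescope_lex[OF L, of F] by simp
  moreover have "cyl L (T L) = cyl L \<sigma>" "cyl L (T {}) = cyl L \<xi>"
    by (rule cyl_cong, simp add: T_def)+
  ultimately show ?thesis by (simp add: F_def)
qed

section \<open>Measurability of the step costs\<close>

lemma measurable_glue:
  "(\<lambda>p. glue (snd p) (fst p)) \<in> measurable (Omega \<Otimes>\<^sub>M Omega) (Omega :: ('d::{finite,linorder}, 'e) config measure)"
proof (rule measurable_into_Omega)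
  fix x :: "(int, 'd) vec"
  show "(\<lambda>p. glue (snd p) (fst p) x) \<in> measurable (Omega \<Otimes>\<^sub>M Omega) (count_space (UNIV :: 'e set))"
    unfolding glue_def
    using measurable_compose[OF measurable_fst measurable_coordinate]
      measurable_compose[OF measurable_snd measurable_coordinate]
    by (cases "x = 0 \<or> lex_less x 0") auto
qed

lemma measurable_fst_coordinate:
  "(\<lambda>p. fst p x) \<in> measurable (Omega \<Otimes>\<^sub>M N) (count_space UNIV)"
  using measurable_compose[OF measurable_fst measurable_coordinate] .

lemma measurable_log_gap:
  fixes \<nu> :: "('d::{finite,linorder}, 'e::finite) config measure"
  assumes "finite L"
  shows "log_gap \<nu> L \<in> borel_measurable (Omega \<Otimes>\<^sub>M Omega)"
proof -
  have f: "(\<lambda>\<omega>. ln (measure \<nu> (cyl L \<omega>))) \<in> borel_measurable Omega"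
    using assms by (intro measurable_depends_on[where L = L] depends_on_cyl) auto
  have g: "(\<lambda>p. (glue (snd p) (fst p))(0 := fst p 0)) \<in> measurable (Omega \<Otimes>\<^sub>M Omega) (Omega :: ('d, 'e) config measure)"
  proof (rule measurable_into_Omega)
    fix x :: "(int, 'd) vec"
    show "(\<lambda>p. ((glue (snd p) (fst p))(0 := fst p 0)) x) \<in> measurable (Omega \<Otimes>\<^sub>M Omega) (count_space (UNIV :: 'e set))"
      using measurable_fst_coordinate[of x] measurable_compose[OF measurable_glue measurable_coordinate[of x]]
      by (cases "x = 0") auto
  qed
  show ?thesis
    unfolding log_gap_def[abs_def]
    by (intro borel_measurable_diff measurable_compose[OF measurable_glue f] measurable_compose[OF g f])
qed

lemma measurable_log_gap_limit:
  fixes \<gamma> :: "((int, 'd::{finite,linorder}) vec) set \<Rightarrow> ('d, 'e::finite) config \<Rightarrow> ('d, 'e) config measure"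
  assumes "is_spec \<gamma>"
  shows "log_gap_limit \<gamma> \<in> borel_measurable (Omega \<Otimes>\<^sub>M Omega)"
proof -
  have q: "(\<lambda>p. ln (site_prob \<gamma> s (glue (snd p) (fst p)))) \<in> borel_measurable (Omega \<Otimes>\<^sub>M Omega)" for s
    using measurable_compose[OF measurable_glue F_alg_measurable_Omega[OF site_prob_F_alg[OF assms]]]
    by (rule borel_measurable_ln)
  \<comment> \<open>The spin index itself varies with the pair, but it takes finitely many
    values.\<close>
  have "(\<lambda>p. ln (site_prob \<gamma> (h p) (glue (snd p) (fst p)))) \<in> borel_measurable (Omega \<Otimes>\<^sub>M Omega)"
    if "h \<in> measurable (Omega \<Otimes>\<^sub>M Omega) (count_space UNIV)" for h
    by (rule measurable_compose_countable'[OF q that]) (auto intro: countable_finite)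
  then show ?thesis
    unfolding log_gap_limit_def[abs_def]
    using measurable_fst_coordinate[of 0] measurable_compose[OF measurable_glue measurable_coordinate[of 0]]
    by (intro borel_measurable_diff) auto
qed

section \<open>Bound and infinite-volume limit of the step costs\<close>

text \<open>The two configurations agree off the origin, so both masses lie between
  \<open>a * ?m\<close> and \<open>?m\<close>, with \<open>a\<close> the nonnull constant of the
  single site. Hence the uniform bound \<open>- ln a\<close>.\<close>

lemma log_gap_bounded:
  fixes \<gamma> :: "((int, 'd::{finite,linorder}) vec) set \<Rightarrow> ('d, 'e) config \<Rightarrow> ('d, 'e) config measure"
  assumes spec: "is_spec \<gamma>" and nn: "nonnull \<gamma>" and G: "Gibbs \<gamma> \<nu>"
  shows "\<exists>K. \<forall>L p. finite L \<longrightarrow> 0 \<in> L \<longrightarrow> \<bar>log_gap \<nu> L p\<bar> \<le> K"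
proof -
  obtain a where a: "a > 0" "\<And>\<sigma> \<eta>. a \<le> measure (\<gamma> {0} \<eta>) (cyl {0} \<sigma>)"
    by (rule nonnull_D[OF nn, of "{0}"]) auto
  have q: "a \<le> site_prob \<gamma> s \<eta> \<and> site_prob \<gamma> s \<eta> \<le> 1" for s \<eta>
    using a site_prob_le_1[OF spec] by (simp add: site_prob_def)
  have "\<bar>log_gap \<nu> L p\<bar> \<le> - ln a" if L: "finite L" "0 \<in> L" for L p
  proof -
    let ?\<omega> = "glue (snd p) (fst p)"
    let ?m = "measure \<nu> (cyl (L - {0}) ?\<omega>)"
    have pos: "?m > 0" using L by (intro Gibbs_cyl_pos[OF spec nn G]) auto
    have b: "ln a + ln ?m \<le> ln (measure \<nu> (cyl L \<omega>)) \<and> ln (measure \<nu> (cyl L \<omega>)) \<le> ln ?m"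
      if "cyl (L - {0}) \<omega> = cyl (L - {0}) ?\<omega>" for \<omega>
    proof -
      have p': "measure \<nu> (cyl L \<omega>) > 0" using L by (intro Gibbs_cyl_pos[OF spec nn G]) auto
      have "a * ?m \<le> measure \<nu> (cyl L \<omega>)" "measure \<nu> (cyl L \<omega>) \<le> 1 * ?m"
        using Gibbs_cyl_bounds[OF spec G L, of \<omega> a 1] q that by auto
      then have "ln (a * ?m) \<le> ln (measure \<nu> (cyl L \<omega>))" "ln (measure \<nu> (cyl L \<omega>)) \<le> ln ?m"
        using pos p' a(1) by simp_all
      then show ?thesis using pos a(1) by (simp add: ln_mult)
    qed
    have "cyl (L - {0}) (?\<omega>(0 := fst p 0)) = cyl (L - {0}) ?\<omega>" by (rule cyl_cong) auto
    from b[OF this] b[OF refl] show ?thesis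
      unfolding log_gap_def by linarith
  qed
  then show ?thesis by blast
qed

text \<open>Both masses are normalised by the same cylinder on \<open>L m - {0}\<close>, which
  cancels in the difference of logarithms.\<close>

lemma log_gap_tendsto:
  fixes \<gamma> :: "((int, 'd::{finite,linorder}) vec) set \<Rightarrow> ('d, 'e) config \<Rightarrow> ('d, 'e) config measure"
  assumes spec: "is_spec \<gamma>" and nn: "nonnull \<gamma>" and G: "Gibbs \<gamma> \<nu>"
    and \<omega>: "glue (snd p) (fst p) \<in> Omega_gamma \<gamma>"
    and L: "\<And>m. finite (L m)" "\<And>m. cube m \<subseteq> L m"
  shows "(\<lambda>m. log_gap \<nu> (L m) p) \<longlonglongrightarrow> log_gap_limit \<gamma> p"
proof -
  let ?\<omega> = "glue (snd p) (fst p)"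
  obtain a where a: "a > 0" "\<And>\<sigma> \<eta>. a \<le> measure (\<gamma> {0} \<eta>) (cyl {0} \<sigma>)"
    by (rule nonnull_D[OF nn, of "{0}"]) auto
  have q: "site_prob \<gamma> s ?\<omega> \<noteq> 0" for s
    using a(1) a(2)[of ?\<omega> "\<lambda>_. s"] by (auto simp: site_prob_def)
  have "(\<lambda>m. ln (measure \<nu> (cyl (L m) (?\<omega>(0 := t))) / measure \<nu> (cyl (L m - {0}) ?\<omega>)))
      \<longlonglongrightarrow> ln (site_prob \<gamma> t ?\<omega>)" for t
    by (intro tendsto_ln Gibbs_cyl_ratio_tendsto[OF spec nn G \<omega> L] q)
  from tendsto_diff[OF this[of "?\<omega> 0"] this[of "fst p 0"]]
  have "(\<lambda>m. ln (measure \<nu> (cyl (L m) ?\<omega>) / measure \<nu> (cyl (L m - {0}) ?\<omega>))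
      - ln (measure \<nu> (cyl (L m) (?\<omega>(0 := fst p 0))) / measure \<nu> (cyl (L m - {0}) ?\<omega>)))
      \<longlonglongrightarrow> log_gap_limit \<gamma> p"
    by (simp add: log_gap_limit_def)
  moreover have "ln (measure \<nu> (cyl (L m) ?\<omega>) / measure \<nu> (cyl (L m - {0}) ?\<omega>))
      - ln (measure \<nu> (cyl (L m) (?\<omega>(0 := fst p 0))) / measure \<nu> (cyl (L m - {0}) ?\<omega>))
      = log_gap \<nu> (L m) p" for m
  proof -
    have "measure \<nu> (cyl K \<omega>) > 0" if "finite K" for K \<omega>
      using that by (rule Gibbs_cyl_pos[OF spec nn G])
    then show ?thesis using L(1) by (simp add: log_gap_def ln_divide_pos)
  qed
  ultimately show ?thesis by simp
qed

text \<open>The telescoping identity is integrated over independent \<xi> and \<sigma> with laws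
  \<open>lam\<close> and \<alpha>; the limit is free of \<nu>, which is what makes two Gibbs
  measures comparable.\<close>

lemma cross_entropy_difference_tendsto:
  fixes \<gamma> :: "((int, 'd::{finite,linorder}) vec) set \<Rightarrow> ('d, 'e::finite) config \<Rightarrow> ('d, 'e) config measure"
  assumes spec: "is_spec \<gamma>" and nn: "nonnull \<gamma>" and \<nu>: "Gibbs_inv \<gamma> \<nu>"
    and lam: "inv_prob lam" and \<alpha>: "inv_prob \<alpha>"
    and C1: "AE p in lam \<Otimes>\<^sub>M \<alpha>. glue (snd p) (fst p) \<in> Omega_gamma \<gamma>"
  shows "(\<lambda>n. ent_seq lam \<nu> n - ent_seq \<alpha> \<nu> n) \<longlonglongrightarrow> (\<integral>p. log_gap_limit \<gamma> p \<partial>(lam \<Otimes>\<^sub>M \<alpha>))"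
proof -
  let ?P = "lam \<Otimes>\<^sub>M \<alpha>"
  have G: "Gibbs \<gamma> \<nu>" and inv: "inv_prob \<nu>"
    using \<nu> by (auto simp: Gibbs_inv_def inv_prob_def Gibbs_def)
  have pl: "prob_on_Omega lam" and pa: "prob_on_Omega \<alpha>"
    using lam \<alpha> by (auto simp: inv_prob_def)
  interpret l: prob_space lam by (rule prob_on_Omega_D(1)[OF pl])
  interpret a: prob_space \<alpha> by (rule prob_on_Omega_D(1)[OF pa])
  interpret P: pair_prob_space lam \<alpha> ..
  note sl = prob_on_Omega_D(2)[OF pl] and sa = prob_on_Omega_D(2)[OF pa]
  have sP: "sets ?P = sets (Omega \<Otimes>\<^sub>M Omega)" by (rule sets_pair_measure_cong[OF sl sa])
  have measP: "f \<in> borel_measurable ?P" if "f \<in> borel_measurable (Omega \<Otimes>\<^sub>M Omega)" for f :: "_ \<Rightarrow> real"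
    using that measurable_cong_sets[OF sP refl] by blast
  obtain K where K: "\<And>L p. finite L \<Longrightarrow> 0 \<in> L \<Longrightarrow> \<bar>log_gap \<nu> L p\<bar> \<le> K"
    using log_gap_bounded[OF spec nn G] by blast
  have intP: "integrable ?P (log_gap \<nu> L)" if "finite L" "0 \<in> L" for L
    by (rule P.P.integrable_const_bound[of _ K])
       (simp_all add: K[OF that] measP[OF measurable_log_gap[OF that(1)]])
  define c where "c = (\<integral>p. log_gap_limit \<gamma> p \<partial>?P)"
  define I where "I L = (\<integral>p. log_gap \<nu> L p \<partial>?P)" for L
  \<comment> \<open>The sequence of windows is arbitrary: dominated convergence is sequential, while
    the averaging needs a statement about all windows containing a large cube.\<close>
  have seq: "(\<lambda>m. I (L m)) \<longlonglongrightarrow> c" if L: "\<And>m. finite (L m)" "\<And>m. cube m \<subseteq> L m" for L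
    unfolding I_def c_def
  proof (rule integral_dominated_convergence[where w = "\<lambda>_. K"])
    show "AE p in ?P. (\<lambda>m. log_gap \<nu> (L m) p) \<longlonglongrightarrow> log_gap_limit \<gamma> p"
      using C1 by eventually_elim (rule log_gap_tendsto[OF spec nn G _ L])
    fix m
    have "0 \<in> L m" using L(2)[of m] zero_in_cube[of m] by blast
    then show "AE p in ?P. norm (log_gap \<nu> (L m) p) \<le> K"
      using K L(1) by (intro AE_I2) simp
  qed (simp_all add: measP measurable_log_gap[OF L(1)] measurable_log_gap_limit[OF spec])
  have avg: "(\<lambda>n. (\<Sum>x\<in>cube n. I ((\<lambda>y. y - x) ` cube n)) / real (card (cube n :: (int, 'd) vec set)))
    \<longlonglongrightarrow> c"
  proof (rule cube_average_tendsto)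
    fix L :: "(int, 'd) vec set" assume L: "finite L" "0 \<in> L"
    have "\<bar>I L\<bar> \<le> (\<integral>p. \<bar>log_gap \<nu> L p\<bar> \<partial>?P)"
      unfolding I_def by (rule integral_abs_bound)
    also have "\<dots> \<le> (\<integral>p. K \<partial>?P)"
      using K L intP by (intro integral_mono) auto
    finally show "\<bar>I L\<bar> \<le> K" using P.P.prob_space by simp
  next
    fix e :: real assume e: "e > 0"
    show "\<exists>m. \<forall>L. finite L \<and> cube m \<subseteq> L \<longrightarrow> \<bar>I L - c\<bar> \<le> e"
    \<comment> \<open>A bad window for every \<open>m\<close> would form a sequence contradicting
      \<open>seq\<close>.\<close>
    proof (rule ccontr)
      assume "\<not> ?thesis"
      then have "\<forall>m. \<exists>L. finite L \<and> cube m \<subseteq> L \<and> \<not> \<bar>I L - c\<bar> \<le> e" by blast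
      from choice[OF this] obtain L where L: "\<And>m. finite (L m)" "\<And>m. cube m \<subseteq> L m"
          "\<And>m. \<not> \<bar>I (L m) - c\<bar> \<le> e"
        by blast
      obtain m where "norm (I (L m) - c) < e" using LIMSEQ_D[OF seq[OF L(1,2)] e] by blast
      with L(3)[of m] show False by simp
    qed
  qed
  have "(\<Sum>x\<in>cube n. I ((\<lambda>y. y - x) ` cube n)) / real (card (cube n :: (int, 'd) vec set))
      = ent_seq lam \<nu> n - ent_seq \<alpha> \<nu> n" for n
  proof -
    let ?C = "cube n :: (int, 'd) vec set"
    let ?f = "\<lambda>\<omega>. ln (measure \<nu> (cyl ?C \<omega>))"
    have fm: "?f \<in> borel_measurable Omega"
      by (intro measurable_depends_on[where L = ?C] depends_on_cyl) auto
    have fl: "?f \<in> borel_measurable lam" and fa: "?f \<in> borel_measurable \<alpha>"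
      using fm by (simp_all only: measurable_cong_sets[OF sl refl] measurable_cong_sets[OF sa refl])
    have da: "distr ?P \<alpha> snd = \<alpha>"
    proof -
      have "distr ?P \<alpha> snd = distr (distr (\<alpha> \<Otimes>\<^sub>M lam) ?P (\<lambda>(x, y). (y, x))) \<alpha> snd"
        using P.distr_pair_swap by simp
      also have "\<dots> = distr (\<alpha> \<Otimes>\<^sub>M lam) \<alpha> fst"
        by (subst distr_distr) (auto simp: comp_def case_prod_unfold intro!: measurable_Pair)
      also have "\<dots> = \<alpha>" by (rule l.distr_pair_fst)
      finally show ?thesis .
    qed
    have "(\<integral>\<omega>. ?f \<omega> \<partial>distr ?P lam fst) = (\<integral>p. ?f (fst p) \<partial>?P)"
      by (rule integral_distr[OF measurable_fst fl])
    then have i1: "(\<integral>\<omega>. ?f \<omega> \<partial>lam) = (\<integral>p. ?f (fst p) \<partial>?P)"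
      by (simp only: a.distr_pair_fst)
    have "(\<integral>\<omega>. ?f \<omega> \<partial>distr ?P \<alpha> snd) = (\<integral>p. ?f (snd p) \<partial>?P)"
      by (rule integral_distr[OF measurable_snd fa])
    then have i2: "(\<integral>\<omega>. ?f \<omega> \<partial>\<alpha>) = (\<integral>p. ?f (snd p) \<partial>?P)"
      by (simp only: da)
    have "integrable (distr ?P lam fst) ?f"
      unfolding a.distr_pair_fst by (rule integrable_ln_cyl[OF pl]) simp
    then have j1: "integrable ?P (\<lambda>p. ?f (fst p))"
      by (simp add: integrable_distr_eq[OF measurable_fst fl])
    have "integrable (distr ?P \<alpha> snd) ?f"
      unfolding da by (rule integrable_ln_cyl[OF pa]) simp
    then have j2: "integrable ?P (\<lambda>p. ?f (snd p))"
      by (simp add: integrable_distr_eq[OF measurable_snd fa])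
    \<comment> \<open>The product law is invariant when both components are shifted by the same
      \<open>x\<close>, so each summand has the integral of a step at the origin with a moved
      window.\<close>
    have shift_inv: "integrable ?P (\<lambda>p. log_gap \<nu> ((\<lambda>y. y - x) ` ?C) (shift x (fst p), shift x (snd p)))
        \<and> (\<integral>p. log_gap \<nu> ((\<lambda>y. y - x) ` ?C) (shift x (fst p), shift x (snd p)) \<partial>?P) = I ((\<lambda>y. y - x) ` ?C)"
      if "x \<in> ?C" for x
    proof -
      let ?s = "\<lambda>p. (shift x (fst p), shift x (snd p))"
      let ?g = "log_gap \<nu> ((\<lambda>y. y - x) ` ?C)"
      have ml: "shift x \<in> measurable lam lam" and ma: "shift x \<in> measurable \<alpha> \<alpha>"
        using measurable_shift[of x]
        by (simp_all only: measurable_cong_sets[OF sl sl] measurable_cong_sets[OF sa sa])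
      have "distr lam lam (shift x) \<Otimes>\<^sub>M distr \<alpha> \<alpha> (shift x) = distr ?P ?P (\<lambda>(u, v). (shift x u, shift x v))"
        by (rule pair_measure_distr[OF ml ma]) (simp add: distr_shift[OF \<alpha>] a.sigma_finite_measure_axioms)
      then have d: "distr ?P ?P ?s = ?P"
        by (simp add: distr_shift[OF \<alpha>] distr_shift[OF lam] case_prod_unfold)
      have ms: "?s \<in> measurable ?P ?P"
        using ml ma by (intro measurable_Pair measurable_compose[OF measurable_fst] measurable_compose[OF measurable_snd])
      have "0 \<in> (\<lambda>y. y - x) ` ?C" using that by (auto intro!: image_eqI[of _ _ x])
      then have g: "integrable ?P ?g" by (intro intP) auto
      have gm: "?g \<in> borel_measurable ?P" using g by auto
      have "integrable (distr ?P ?P ?s) ?g" unfolding d by (rule g)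
      then have "integrable ?P (\<lambda>p. ?g (?s p))" by (simp only: integrable_distr_eq[OF ms gm])
      moreover have "(\<integral>p. ?g p \<partial>distr ?P ?P ?s) = (\<integral>p. ?g (?s p) \<partial>?P)"
        by (rule integral_distr[OF ms gm])
      ultimately show ?thesis
        unfolding d I_def by simp
    qed
    have "(\<Sum>x\<in>?C. I ((\<lambda>y. y - x) ` ?C))
        = (\<Sum>x\<in>?C. \<integral>p. log_gap \<nu> ((\<lambda>y. y - x) ` ?C) (shift x (fst p), shift x (snd p)) \<partial>?P)"
      using shift_inv by (intro sum.cong) auto
    also have "\<dots> = (\<integral>p. (\<Sum>x\<in>?C. log_gap \<nu> ((\<lambda>y. y - x) ` ?C) (shift x (fst p), shift x (snd p))) \<partial>?P)"
      using shift_inv by (intro Bochner_Integration.integral_sum[symmetric]) auto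
    \<comment> \<open>The sign in \<open>ent_seq\<close> reverses this into cross entropy under
      \<open>lam\<close> minus cross entropy under \<alpha>.\<close>
    also have "\<dots> = (\<integral>p. ?f (snd p) - ?f (fst p) \<partial>?P)"
      by (simp only: ln_cyl_telescope[OF inv finite_cube])
    also have "\<dots> = (\<integral>\<omega>. ?f \<omega> \<partial>\<alpha>) - (\<integral>\<omega>. ?f \<omega> \<partial>lam)"
      unfolding i1 i2 by (rule Bochner_Integration.integral_diff[OF j2 j1])
    finally show ?thesis
      by (simp add: ent_seq_def diff_divide_distrib)
  qed
  with avg show ?thesis unfolding c_def by simp
qed

section \<open>Relative entropy and C2' as differences of cross entropies, and the
  conclusion\<close>

text \<open>Positivity is asked of \<nu> only, since the first measure will also be an \<alpha> that
  need not be Gibbs; its null cylinders have weight 0.\<close>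

lemma rel_ent_seq_eq:
  fixes \<mu> :: "('d::finite, 'e::finite) config measure"
  assumes p: "prob_on_Omega \<mu>" and pos: "\<And>L \<omega>. finite L \<Longrightarrow> measure \<nu> (cyl L \<omega>) > 0"
  shows "rel_ent_seq \<mu> \<nu> n = ent_seq \<mu> \<nu> n - ent_seq \<mu> \<mu> n"
proof -
  let ?C = "cube n :: (int, 'd) vec set"
  let ?m = "\<lambda>\<rho> \<sigma>. measure \<rho> (cyl ?C \<sigma>)"
  have int: "(\<integral>\<omega>. ln (?m \<rho> \<omega>) \<partial>\<mu>) = (\<Sum>\<sigma>\<in>PiE ?C (\<lambda>_. UNIV). ?m \<mu> \<sigma> * ln (?m \<rho> \<sigma>))" for \<rho>
    by (intro integral_depends_on(2)[OF p] depends_on_cyl) auto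
  have "h_local ?C \<mu> \<nu> = (\<Sum>\<sigma>\<in>PiE ?C (\<lambda>_. UNIV). ?m \<mu> \<sigma> * ln (?m \<mu> \<sigma>) - ?m \<mu> \<sigma> * ln (?m \<nu> \<sigma>))"
    unfolding h_local_def
  proof (rule sum.cong[OF refl])
    fix \<sigma> :: "('d, 'e) config"
    show "?m \<mu> \<sigma> * ln (?m \<mu> \<sigma> / ?m \<nu> \<sigma>) = ?m \<mu> \<sigma> * ln (?m \<mu> \<sigma>) - ?m \<mu> \<sigma> * ln (?m \<nu> \<sigma>)"
      using pos[OF finite_cube, of n \<sigma>]
      by (cases "?m \<mu> \<sigma> = 0") (simp_all add: ln_div zero_less_measure_iff right_diff_distrib)
  qed
  then have "h_local ?C \<mu> \<nu> = (\<integral>\<omega>. ln (?m \<mu> \<omega>) \<partial>\<mu>) - (\<integral>\<omega>. ln (?m \<nu> \<omega>) \<partial>\<mu>)"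
    by (simp add: int sum_subtractf)
  then show ?thesis
    by (simp add: rel_ent_seq_def ent_seq_def diff_divide_distrib)
qed

text \<open>The integrating measure is unrelated to \<mu> and \<nu>, so the logarithm of the
  quotient is split at every \<xi>, using positivity of both.\<close>

lemma C2_seq_eq:
  fixes \<mu> :: "('d::finite, 'e::finite) config measure"
  assumes p: "prob_on_Omega lam" and pos: "\<And>L \<omega>. finite L \<Longrightarrow> measure \<mu> (cyl L \<omega>) > 0"
    "\<And>L \<omega>. finite L \<Longrightarrow> measure \<nu> (cyl L \<omega>) > 0"
  shows "C2_seq lam \<mu> \<nu> n = ent_seq lam \<nu> n - ent_seq lam \<mu> n"
proof -
  have "ln (measure \<mu> (cyl (cube n) \<xi>) / measure \<nu> (cyl (cube n) \<xi>))
      = ln (measure \<mu> (cyl (cube n) \<xi>)) - ln (measure \<nu> (cyl (cube n) \<xi>))" for \<xi>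
    by (rule ln_divide_pos[OF pos(1)[OF finite_cube] pos(2)[OF finite_cube]])
  then show ?thesis
    by (simp add: C2_seq_def ent_seq_def Bochner_Integration.integral_diff
        integrable_ln_cyl[OF p finite_cube] diff_divide_distrib)
qed

theorem theorem3p10:
  fixes \<gamma> :: "((int, 'd::{finite,linorder}) vec) set \<Rightarrow> ('d, 'e::finite) config \<Rightarrow> ('d, 'e) config measure"
    and lam \<mu> \<nu> :: "('d, 'e) config measure"
  assumes spec: "is_spec \<gamma>" and nn: "nonnull \<gamma>" and ti: "spec_translation_invariant \<gamma>"
    and lam: "inv_prob lam"
    and mu: "Gibbs_inv \<gamma> \<mu>" and nu: "Gibbs_inv \<gamma> \<nu>"
    and C1: "AE p in lam \<Otimes>\<^sub>M \<mu>. glue (snd p) (fst p) \<in> Omega_gamma \<gamma>"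
    and C2: "C2_seq lam \<mu> \<nu> \<longlonglongrightarrow> 0"
  shows "rel_ent_seq \<mu> \<nu> \<longlonglongrightarrow> 0
         \<and> (convergent (ent_seq lam \<nu>) \<and> ent_seq lam \<mu> \<longlonglongrightarrow> lim (ent_seq lam \<nu>))
         \<and> (\<forall>\<alpha>. inv_prob \<alpha> \<and> (AE p in lam \<Otimes>\<^sub>M \<alpha>. glue (snd p) (fst p) \<in> Omega_gamma \<gamma>)
               \<longrightarrow> convergent (rel_ent_seq \<alpha> \<nu>))"
proof -
  have inv_mu: "inv_prob \<mu>" and G_mu: "Gibbs \<gamma> \<mu>" and G_nu: "Gibbs \<gamma> \<nu>"
    using mu nu by (auto simp: Gibbs_inv_def inv_prob_def Gibbs_def)
  have p_mu: "prob_on_Omega \<mu>" and p_lam: "prob_on_Omega lam"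
    using inv_mu lam by (auto simp: inv_prob_def)
  note pos_mu = Gibbs_cyl_pos[OF spec nn G_mu] and pos_nu = Gibbs_cyl_pos[OF spec nn G_nu]
  define c where "c = (\<integral>p. log_gap_limit \<gamma> p \<partial>(lam \<Otimes>\<^sub>M \<mu>))"
  have lim_mu: "(\<lambda>n. ent_seq lam \<mu> n - ent_seq \<mu> \<mu> n) \<longlonglongrightarrow> c"
    unfolding c_def by (rule cross_entropy_difference_tendsto[OF spec nn mu lam inv_mu C1])
  have lim_nu: "(\<lambda>n. ent_seq lam \<nu> n - ent_seq \<mu> \<nu> n) \<longlonglongrightarrow> c"
    unfolding c_def by (rule cross_entropy_difference_tendsto[OF spec nn nu lam inv_mu C1])
  have C2': "(\<lambda>n. ent_seq lam \<nu> n - ent_seq lam \<mu> n) \<longlonglongrightarrow> 0"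
  proof -
    have "C2_seq lam \<mu> \<nu> = (\<lambda>n. ent_seq lam \<nu> n - ent_seq lam \<mu> n)"
      using C2_seq_eq[OF p_lam] pos_mu pos_nu by blast
    with C2 show ?thesis by simp
  qed
  have rel_eq: "rel_ent_seq \<alpha> \<nu> = (\<lambda>n. ent_seq \<alpha> \<nu> n - ent_seq \<alpha> \<alpha> n)" if "prob_on_Omega \<alpha>" for \<alpha>
    using rel_ent_seq_eq[OF that] pos_nu by blast
  \<comment> \<open>The cross entropies under \<open>lam\<close> cancel identically, leaving the
    relative entropy per site of \<mu> with respect to \<nu>.\<close>
  have "(\<lambda>n. (ent_seq lam \<mu> n - ent_seq \<mu> \<mu> n) - (ent_seq lam \<nu> n - ent_seq \<mu> \<nu> n)
      + (ent_seq lam \<nu> n - ent_seq lam \<mu> n)) \<longlonglongrightarrow> c - c + 0"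
    by (intro tendsto_intros lim_mu lim_nu C2')
  then have rel: "rel_ent_seq \<mu> \<nu> \<longlonglongrightarrow> 0"
    by (simp add: rel_eq[OF p_mu])
  obtain h where h: "ent_seq \<mu> \<mu> \<longlonglongrightarrow> h"
    using convergent_ent_seq_self[OF inv_mu] by (auto simp: convergent_def)
  have ent_mu: "ent_seq lam \<mu> \<longlonglongrightarrow> c + h"
    using tendsto_add[OF lim_mu h] by simp
  have ent_nu: "ent_seq lam \<nu> \<longlonglongrightarrow> c + h"
    using tendsto_add[OF C2' ent_mu] by simp
  have "convergent (rel_ent_seq \<alpha> \<nu>)"
    if a: "inv_prob \<alpha>" "AE p in lam \<Otimes>\<^sub>M \<alpha>. glue (snd p) (fst p) \<in> Omega_gamma \<gamma>" for \<alpha>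
  proof -
    have p_a: "prob_on_Omega \<alpha>" using a(1) by (simp add: inv_prob_def)
    obtain k where k: "ent_seq \<alpha> \<alpha> \<longlonglongrightarrow> k"
      using convergent_ent_seq_self[OF a(1)] by (auto simp: convergent_def)
    \<comment> \<open>With the limit of \<open>ent_seq lam \<nu>\<close> known from claim (2), this
      yields the cross entropy of \<alpha> against \<nu>; subtracting the entropy density
      \<open>k\<close> gives the relative entropy.\<close>
    note d = cross_entropy_difference_tendsto[OF spec nn nu lam a]
    have "rel_ent_seq \<alpha> \<nu> \<longlonglongrightarrow> (c + h) - (\<integral>p. log_gap_limit \<gamma> p \<partial>(lam \<Otimes>\<^sub>M \<alpha>)) - k"
      using tendsto_diff[OF tendsto_diff[OF ent_nu d] k]
      by (simp add: rel_eq[OF p_a])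
    then show ?thesis by (auto simp: convergent_def)
  qed
  moreover have "convergent (ent_seq lam \<nu>)" "lim (ent_seq lam \<nu>) = c + h"
    using ent_nu limI by (auto simp: convergent_def)
  ultimately show ?thesis using rel ent_mu by simp
qed

end
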